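(* Let $n\ge2$ and let $a_1,\dots,a_{n+1}$, $B_n$, $C_n$ be as in the context. Let $m=\max B_n$ and $\mu=a_{[1,n+1]}$, and set $I_{B_n}=\langle X^{m-b}Y^b: b\in B_n\rangle$ and $I_{C_n}=\langle X^{\mu-c}Y^c:c\in C_n\rangle$. Then: (1) $I_{B_n}$ is an atom of $\mathcal I(R)$; (2) $\{2,n+1\}\subseteq\mathsf L_{\mathcal I(R)}(I_{C_n})\subseteq[2,n+1]$.
   Context: Let $D$ be an integral domain, $N\ge2$, $R=D[X_1,\dots,X_N]$, $X=X_1$, $Y=X_2$. $\mathcal I(R)$ denotes the monoid of nonzero ideals of $R$ under ideal multiplication (identity $R$, whose only unit is $R$). Standing assumption: $\mathcal I(R)$ is a BF-monoid. An atom of $\mathcal I(R)$ is an ideal $I\in\mathcal I(R)$, $I\ne R$, such that $I=\mathfrak a\mathfrak b$ with $\mathfrak a,\mathfrak b\in\mathcal I(R)$ forces $\mathfrak a=R$ or $\mathfrak b=R$. $\mathsf L_{\mathcal I(R)}(I)$ is the set of all $k$ such that $I$ is a product of $k$ atoms of $\mathcal I(R)$. $[x,y]=\{z\in\mathbb Z:x\le z\le y\}$. Fix an integer $n\ge2$ and positive integers $a_1,\dots,a_{n+1}$ with (C1) $a_{n+1}=a_1+\dots+a_{n-1}+2a_n$ and (C2) $a_{i+1}>2(a_1+\dots+a_i)$ for all $i\in[1,n-1]$. For $I\subseteq[1,n+1]$ put $a_I=\sum_{i\in I}a_i$ ($a_\emptyset=0$). Define $A_n=\{a_I:I\subseteq[1,n-1]\}$,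 $B_n=A_n\cup\{a_{[1,n]}\}\cup(A_n+a_{n+1})$, $C_n=\{a_I:I\subseteq[1,n+1]\}$. *)

theory Defs
  imports Main "HOL-Library.Poly_Mapping" "HOL-Library.Cardinality"
begin

(* Polynomial ring D[X_v : v \<in> 'v] over coefficient type 'a, with monomials
   represented as exponent vectors 'v \<Rightarrow>\<^sub>0 nat.  For a finite index type 'v
   with CARD('v) = N this is D[X_1,...,X_N]. *)
type_synonym ('v, 'a) mpoly = "('v \<Rightarrow>\<^sub>0 nat) \<Rightarrow>\<^sub>0 'a"

definition monoXY :: "'v \<Rightarrow> 'v \<Rightarrow> nat \<Rightarrow> nat \<Rightarrow> ('v, 'a::comm_ring_1) mpoly" where
  "monoXY x y i j = Poly_Mapping.single (Poly_Mapping.single x i + Poly_Mapping.single y j) 1"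

definition is_ideal :: "'r::comm_ring_1 set \<Rightarrow> bool" where
  "is_ideal I \<longleftrightarrow> 0 \<in> I \<and> (\<forall>a\<in>I. \<forall>b\<in>I. a + b \<in> I) \<and> (\<forall>r. \<forall>a\<in>I. r * a \<in> I)"

definition ideal_gen :: "'r::comm_ring_1 set \<Rightarrow> 'r set" where
  "ideal_gen S = \<Inter>{I. is_ideal I \<and> S \<subseteq> I}"

definition ideal_mult :: "'r::comm_ring_1 set \<Rightarrow> 'r set \<Rightarrow> 'r set" where
  "ideal_mult I J = ideal_gen {a * b | a b. a \<in> I \<and> b \<in> J}"

definition nz_ideal :: "'r::comm_ring_1 set \<Rightarrow> bool" where
  "nz_ideal I \<longleftrightarrow> is_ideal I \<and> I \<noteq> {0}"

(* atoms of \<I>(R) (the only unit is R = UNIV) *)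
definition ideal_atom :: "'r::comm_ring_1 set \<Rightarrow> bool" where
  "ideal_atom I \<longleftrightarrow> nz_ideal I \<and> I \<noteq> UNIV \<and>
     (\<forall>A B. nz_ideal A \<longrightarrow> nz_ideal B \<longrightarrow> I = ideal_mult A B \<longrightarrow> A = UNIV \<or> B = UNIV)"

definition ideal_prod :: "'r::comm_ring_1 set list \<Rightarrow> 'r set" where
  "ideal_prod Is = foldr ideal_mult Is UNIV"

definition ideal_lengths :: "'r::comm_ring_1 set \<Rightarrow> nat set" where
  "ideal_lengths I = {k. \<exists>Is. length Is = k \<and> (\<forall>A\<in>set Is. ideal_atom A) \<and> ideal_prod Is = I}"

definition ideal_BF :: "'r::comm_ring_1 itself \<Rightarrow> bool" where
  "ideal_BF _ \<longleftrightarrow> (\<forall>I::'r set. nz_ideal I \<and> I \<noteq> UNIV \<longrightarrow>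
      ideal_lengths I \<noteq> {} \<and> finite (ideal_lengths I))"

definition setA :: "(nat \<Rightarrow> nat) \<Rightarrow> nat \<Rightarrow> nat set" where
  "setA a n = (\<lambda>I. \<Sum>i\<in>I. a i) ` Pow {1..n-1}"

definition setB :: "(nat \<Rightarrow> nat) \<Rightarrow> nat \<Rightarrow> nat set" where
  "setB a n = setA a n \<union> {\<Sum>i\<in>{1..n}. a i} \<union> (\<lambda>t. t + a (n+1)) ` setA a n"

definition setC :: "(nat \<Rightarrow> nat) \<Rightarrow> nat \<Rightarrow> nat set" where
  "setC a n = (\<lambda>I. \<Sum>i\<in>I. a i) ` Pow {1..n+1}"

end

theory Submission
  imports
    Defs
    "HOL-Computational_Algebra.Polynomial"
    "HOL-Library.Countable"
    "HOL-Library.Set_Algebras"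
begin

text \<open>
  Suppose $I J$ is generated by the monomials $X^{m-b} Y^b$ with $b \in B$ and $0, m \in B$.
  Dehomogenizing the parts of lowest degree in $X, Y$ of the elements of $I$ and $J$ gives modules
  $V$ and $W$ of polynomials in $Y$ such that $V W$ is spanned by the $Y^b$. The orders at $Y = 0$
  of the elements of $V$ and $W$ form sets $S, T$ containing $0$ with $S + T \subseteq B$, and
  $S = \{0\}$ forces $I$ to be the unit ideal. The main tool is that a gap in $S$ between $0$ and
  $k$ puts every element of $B$ below $k$ into $T$.

  For the set $B_n$, with middle element $c = a_{[1,n]}$: if $c \in S$ then $T = \{0\}$. If $c$
  lies in neither $S$ nor $T$, comparing coefficients in $(f g)(f' g') = (f g')(f' g)$ just above
  degree $c$ shows that no product $f g$ involves $Y^c$, which is absurd.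

  If $I_{C_n}$ is a product of $k$ atoms, each factor contributes an order $s_i > 0$, and all subset
  sums of $s_1, \dots, s_k$ lie in $C_n$; the growth of the $a_i$ then forces $k \le n + 1$.
  The lengths $2$ and $n + 1$ come from $C_n = B_n + \{0, a_n\}$ and
  $C_n = \{0, a_1\} + \dots + \{0, a_{n+1}\}$.
\<close>

section \<open>Ideal arithmetic\<close>

text \<open>
  The rule \<open>scale_scale\<close> reassociates all products to the left, which would loop with
  \<open>ac_simps\<close> and \<open>algebra_simps\<close>.
\<close>

interpretation ideal: module "(*) :: 'r::comm_ring_1 \<Rightarrow> 'r \<Rightarrow> 'r"
  by unfold_locales (simp_all add: algebra_simps)

declare ideal.scale_scale [simp del]

lemma is_ideal_eq_subspace: "is_ideal = ideal.subspace"
  by (simp add: fun_eq_iff is_ideal_def ideal.subspace_def)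

lemma ideal_gen_eq_span: "ideal_gen = ideal.span"
  by (simp add: fun_eq_iff ideal_gen_def ideal.span_def hull_def is_ideal_eq_subspace)

lemmas is_ideal_UNIV = ideal.subspace_UNIV[folded is_ideal_eq_subspace]
lemmas is_ideal_0 = ideal.subspace_0[folded is_ideal_eq_subspace]
lemmas is_ideal_add = ideal.subspace_add[folded is_ideal_eq_subspace]
lemmas is_ideal_diff = ideal.subspace_diff[folded is_ideal_eq_subspace]
lemmas is_ideal_mult_left = ideal.subspace_scale[folded is_ideal_eq_subspace]
lemmas is_ideal_sum = ideal.subspace_sum[folded is_ideal_eq_subspace]

lemmas is_ideal_ideal_gen = ideal.subspace_span[folded is_ideal_eq_subspace ideal_gen_eq_span]
lemmas ideal_gen_base = ideal.span_base[folded ideal_gen_eq_span]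
lemmas ideal_gen_minimal = ideal.span_minimal[folded is_ideal_eq_subspace ideal_gen_eq_span]

lemma is_ideal_mult_right: "is_ideal A \<Longrightarrow> a \<in> A \<Longrightarrow> a * r \<in> A"
  by (simp add: is_ideal_mult_left mult.commute[of a])

lemma is_ideal_eq_UNIV_iff: "is_ideal A \<Longrightarrow> A = UNIV \<longleftrightarrow> 1 \<in> A"
  using is_ideal_mult_right[of A 1] by auto

lemma ideal_mult_eq: "ideal_mult A B = ideal_gen (A * B)"
  unfolding ideal_mult_def set_times_def by (rule arg_cong[where f = ideal_gen]) blast

lemma is_ideal_ideal_mult: "is_ideal (ideal_mult A B)"
  by (simp add: ideal_mult_eq is_ideal_ideal_gen)

lemma mult_mem_ideal_mult: "a \<in> A \<Longrightarrow> b \<in> B \<Longrightarrow> a * b \<in> ideal_mult A B"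
  unfolding ideal_mult_eq by (intro ideal_gen_base set_times_intro)

lemma ideal_mult_commute: "ideal_mult A B = ideal_mult B A"
  by (simp add: ideal_mult_eq mult.commute)

lemma ideal_mult_ideal_gen_left: "ideal_mult (ideal_gen S) T = ideal_mult S T"
proof
  have "is_ideal {s. \<forall>t\<in>T. s * t \<in> ideal_mult S T}"
    using is_ideal_ideal_mult[of S T] by (auto simp: is_ideal_def distrib_right mult.assoc)
  moreover have "S \<subseteq> {s. \<forall>t\<in>T. s * t \<in> ideal_mult S T}"
    by (auto intro: mult_mem_ideal_mult)
  ultimately have "ideal_gen S \<subseteq> {s. \<forall>t\<in>T. s * t \<in> ideal_mult S T}"
    by (intro ideal_gen_minimal)
  then have "ideal_gen S * T \<subseteq> ideal_mult S T"
    by (auto simp: set_times_def)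
  then show "ideal_mult (ideal_gen S) T \<subseteq> ideal_mult S T"
    unfolding ideal_mult_eq[of "ideal_gen S"] by (intro ideal_gen_minimal is_ideal_ideal_mult)
next
  have "S * T \<subseteq> ideal_mult (ideal_gen S) T"
    by (auto simp: set_times_def intro: mult_mem_ideal_mult ideal_gen_base)
  then show "ideal_mult S T \<subseteq> ideal_mult (ideal_gen S) T"
    unfolding ideal_mult_eq[of S] by (intro ideal_gen_minimal is_ideal_ideal_mult)
qed

lemma ideal_mult_ideal_gen_right: "ideal_mult S (ideal_gen T) = ideal_mult S T"
  by (metis ideal_mult_commute ideal_mult_ideal_gen_left)

lemma ideal_mult_assoc: "ideal_mult (ideal_mult A B) C = ideal_mult A (ideal_mult B C)"
proof -
  have "ideal_mult (ideal_mult A B) C = ideal_gen (A * B * C)"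
    by (simp only: ideal_mult_eq[of A B] ideal_mult_ideal_gen_left) (rule ideal_mult_eq)
  also have "\<dots> = ideal_mult A (B * C)"
    by (simp add: ideal_mult_eq mult.assoc)
  also have "\<dots> = ideal_mult A (ideal_mult B C)"
    by (simp only: ideal_mult_eq[of B C] ideal_mult_ideal_gen_right)
  finally show ?thesis .
qed

lemma ideal_mult_subset_left: "is_ideal A \<Longrightarrow> ideal_mult A B \<subseteq> A"
  unfolding ideal_mult_eq
  by (intro ideal_gen_minimal) (auto simp: set_times_def is_ideal_mult_right)

lemma ideal_mult_UNIV: "is_ideal A \<Longrightarrow> ideal_mult A UNIV = A"
  using mult_mem_ideal_mult[of _ A 1 UNIV] ideal_mult_subset_left[of A UNIV] by auto

lemma is_ideal_ideal_prod: "is_ideal (ideal_prod Js)"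
  by (cases Js) (simp_all add: ideal_prod_def is_ideal_UNIV is_ideal_ideal_mult)

lemma ideal_prod_Nil: "ideal_prod [] = UNIV"
  by (simp add: ideal_prod_def)

lemma ideal_prod_Cons: "ideal_prod (J # Js) = ideal_mult J (ideal_prod Js)"
  by (simp add: ideal_prod_def)

lemma ideal_prod_singleton: "is_ideal J \<Longrightarrow> ideal_prod [J] = J"
  by (simp add: ideal_prod_def ideal_mult_UNIV)

lemma ideal_prod_split_factor:
  assumes "J \<in> set Js"
  obtains J' where "is_ideal J'" "ideal_prod Js = ideal_mult J J'"
proof -
  have "\<exists>J'. is_ideal J' \<and> ideal_prod Js = ideal_mult J J'"
    using assms
  proof (induction Js)
    case (Cons H Js)
    then consider (head) "J = H"
      | (tail) J' where "is_ideal J'" "ideal_prod Js = ideal_mult J J'"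
      by auto
    then show ?case
    proof cases
      case head
      then show ?thesis using is_ideal_ideal_prod ideal_prod_Cons by blast
    next
      case tail
      then have "ideal_prod (H # Js) = ideal_mult J (ideal_mult H J')"
        by (metis ideal_prod_Cons ideal_mult_assoc ideal_mult_commute)
      then show ?thesis using is_ideal_ideal_mult by blast
    qed
  qed simp
  then show thesis using that by blast
qed

lemma zero_mem_ideal_lengths_UNIV: "0 \<in> ideal_lengths UNIV"
  by (simp add: ideal_lengths_def ideal_prod_Nil)

lemma Suc_mem_ideal_lengths:
  assumes "ideal_atom J" "k \<in> ideal_lengths I"
  shows "Suc k \<in> ideal_lengths (ideal_mult J I)"
proof -
  obtain Js where "length Js = k" "\<forall>A\<in>set Js. ideal_atom A" "ideal_prod Js = I"
    using assms(2) by (auto simp: ideal_lengths_def)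
  then show ?thesis
    unfolding ideal_lengths_def using assms(1)
    by (intro CollectI exI[of _ "J # Js"]) (simp add: ideal_prod_Cons)
qed

lemma ideal_lengths_ideal_mult_atoms:
  assumes "ideal_atom A" "ideal_atom B"
  shows "2 \<in> ideal_lengths (ideal_mult A B)"
    and "k \<in> ideal_lengths (ideal_mult A B) \<Longrightarrow> 2 \<le> k"
proof -
  have "ideal_mult B UNIV = B"
    using assms(2) by (simp add: ideal_atom_def nz_ideal_def ideal_mult_UNIV)
  then have "Suc 0 \<in> ideal_lengths B"
    using Suc_mem_ideal_lengths[OF assms(2) zero_mem_ideal_lengths_UNIV] by simp
  then show "2 \<in> ideal_lengths (ideal_mult A B)"
    using Suc_mem_ideal_lengths[OF assms(1)] by (simp add: numeral_2_eq_2)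
next
  assume "k \<in> ideal_lengths (ideal_mult A B)"
  then obtain Js where Js: "length Js = k" "\<forall>J\<in>set Js. ideal_atom J"
      "ideal_prod Js = ideal_mult A B"
    by (auto simp: ideal_lengths_def)
  have "ideal_mult A B \<noteq> UNIV"
    using assms ideal_mult_subset_left[of A B] by (auto simp: ideal_atom_def nz_ideal_def)
  then have "k \<noteq> 0" using Js by (auto simp: ideal_prod_Nil)
  moreover have "k \<noteq> 1"
  proof
    assume "k = 1"
    then obtain J where "Js = [J]" using Js(1) by (auto simp: length_Suc_conv)
    then have "ideal_atom J" "J = ideal_mult A B"
      using Js(2,3) by (auto simp: ideal_prod_singleton ideal_atom_def nz_ideal_def)
    then show False using assms unfolding ideal_atom_def by blast
  qed
  ultimately show "2 \<le> k" by simp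
qed

definition radical :: "'r::comm_ring_1 set \<Rightarrow> 'r set" where
  "radical A = {r. \<exists>m. r ^ m \<in> A}"

lemma is_ideal_radical:
  assumes A: "is_ideal A"
  shows "is_ideal (radical A)"
proof -
  have "0 \<in> radical A"
    unfolding radical_def using is_ideal_0[OF A] by (intro CollectI exI[of _ 1]) simp
  moreover have "a + b \<in> radical A" if ab: "a \<in> radical A" "b \<in> radical A" for a b
  proof -
    obtain m n where mn: "a ^ m \<in> A" "b ^ n \<in> A" using ab by (auto simp: radical_def)
    have "a ^ i \<in> A \<or> b ^ (m + n - i) \<in> A" for i
    proof (cases "m \<le> i")
      case True
      then have "a ^ i = a ^ m * a ^ (i - m)" by (simp flip: power_add)
      then show ?thesis using mn(1) A by (simp add: is_ideal_mult_right)
    next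
      case False
      then have "b ^ (m + n - i) = b ^ (m - i) * b ^ n"
        by (simp add: add.commute flip: power_add)
      then show ?thesis using mn(2) A by (simp add: is_ideal_mult_left)
    qed
    then have "of_nat (m + n choose i) * a ^ i * b ^ (m + n - i) \<in> A" for i
      using A by (meson is_ideal_mult_left is_ideal_mult_right)
    then have "(a + b) ^ (m + n) \<in> A"
      unfolding binomial_ring by (intro is_ideal_sum[OF A])
    then show ?thesis by (auto simp: radical_def)
  qed
  moreover have "r * a \<in> radical A" if "a \<in> radical A" for r a
    using that A by (auto simp: radical_def power_mult_distrib intro: is_ideal_mult_left)
  ultimately show ?thesis by (simp add: is_ideal_def)
qed

lemma is_ideal_eq_UNIV_if_unit_mod_radical:
  assumes A: "is_ideal A" and "u \<in> A" "1 - u \<in> radical A"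
  shows "A = UNIV"
proof -
  obtain m where m: "(1 - u) ^ m \<in> A" using assms(3) by (auto simp: radical_def)
  have "1 - (1 - u) ^ m = u * (\<Sum>i<m. (1 - u) ^ i)" by (simp add: one_diff_power_eq)
  then have "1 - (1 - u) ^ m \<in> A" using assms(1,2) by (simp add: is_ideal_mult_right)
  then have "(1 - (1 - u) ^ m) + (1 - u) ^ m \<in> A" using A m by (intro is_ideal_add)
  then show ?thesis using A by (simp add: is_ideal_eq_UNIV_iff)
qed

inductive_set product_span :: "'r::semiring_0 set \<Rightarrow> 'r set \<Rightarrow> 'r set" for A B where
  zero: "0 \<in> product_span A B"
| add_mult: "a \<in> A \<Longrightarrow> b \<in> B \<Longrightarrow> z \<in> product_span A B \<Longrightarrow> a * b + z \<in> product_span A B"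

lemma ideal_mult_eq_product_span:
  assumes "is_ideal A"
  shows "ideal_mult A B = product_span A B"
proof
  show "product_span A B \<subseteq> ideal_mult A B"
  proof
    fix z assume "z \<in> product_span A B"
    then show "z \<in> ideal_mult A B"
      by induction (auto intro: is_ideal_0 is_ideal_add is_ideal_ideal_mult mult_mem_ideal_mult)
  qed
  show "ideal_mult A B \<subseteq> product_span A B"
  proof
    fix z assume "z \<in> ideal_mult A B"
    then have "z \<in> ideal.span (A * B)" by (simp add: ideal_mult_eq ideal_gen_eq_span)
    then show "z \<in> product_span A B"
    proof (induction rule: ideal.span_induct_alt)
      case (step r p z)
      then obtain a b where "p = a * b" "a \<in> A" "b \<in> B" by (auto simp: set_times_def)
      then show ?case
        using product_span.add_mult[of "r * a" A b B z] step assms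
        by (simp add: is_ideal_mult_left mult.assoc)
    qed (rule product_span.zero)
  qed
qed

lemma additive_product_span_eq_0:
  assumes "additive h" "\<And>a b. a \<in> A \<Longrightarrow> b \<in> B \<Longrightarrow> h (a * b) = 0" "z \<in> product_span A B"
  shows "h z = 0"
  using assms(3,2) by induction (simp_all add: additive.zero[OF assms(1)] additive.add[OF assms(1)])

section \<open>Vanishing orders of products of polynomial modules\<close>

lemma coeff_below_order_0:
  fixes p :: "'e::idom poly"
  assumes "i < order 0 p"
  shows "coeff p i = 0"
proof (cases "p = 0")
  case False
  then have "monom 1 (order 0 p) dvd p" by (simp add: monom_1_dvd_iff)
  then show ?thesis using assms unfolding monom_1_dvd_iff' by blast
qed simp

lemma order_0_eq_iff:
  fixes p :: "'e::idom poly"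
  assumes "p \<noteq> 0"
  shows "order 0 p = n \<longleftrightarrow> coeff p n \<noteq> 0 \<and> (\<forall>i<n. coeff p i = 0)"
proof -
  have "order 0 p = n \<longleftrightarrow> monom 1 n dvd p \<and> \<not> monom 1 (Suc n) dvd p"
    using assms by (auto simp: monom_1_dvd_iff)
  also have "\<dots> \<longleftrightarrow> coeff p n \<noteq> 0 \<and> (\<forall>i<n. coeff p i = 0)"
    unfolding monom_1_dvd_iff' by (auto simp: less_Suc_eq)
  finally show ?thesis .
qed

lemma coeff_order_0: "p \<noteq> 0 \<Longrightarrow> coeff p (order 0 p) \<noteq> (0 :: 'e::idom)"
  using order_0_eq_iff by blast

lemma coeff_mult_initial:
  fixes p q :: "'e::comm_ring_1 poly"
  assumes "\<And>i. i < s \<Longrightarrow> coeff p i = 0" "\<And>i. i < t \<Longrightarrow> coeff q i = 0"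
  shows "k < s + t \<Longrightarrow> coeff (p * q) k = 0"
    and "coeff (p * q) (s + t) = coeff p s * coeff q t"
proof -
  obtain p' q' where p: "p = monom 1 s * p'" and q: "q = monom 1 t * q'"
    using assms by (meson monom_1_dvd_iff' dvdE)
  have "p * q = (monom 1 s * monom 1 t) * (p' * q')" by (simp only: p q ac_simps)
  then have "p * q = monom 1 (s + t) * (p' * q')" by (simp add: mult_monom)
  then show "k < s + t \<Longrightarrow> coeff (p * q) k = 0"
    and "coeff (p * q) (s + t) = coeff p s * coeff q t"
    by (simp_all add: p q coeff_monom_mult coeff_mult_0)
qed

definition orders :: "'e::idom poly set \<Rightarrow> nat set" where
  "orders V = order 0 ` (V - {0})"

lemma ordersI: "f \<in> V \<Longrightarrow> f \<noteq> 0 \<Longrightarrow> order 0 f \<in> orders V"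
  by (simp add: orders_def)

lemma ordersE:
  assumes "d \<in> orders V"
  obtains f where "f \<in> V" "f \<noteq> 0" "order 0 f = d"
  using assms by (auto simp: orders_def)

lemma orders_product_span_add:
  assumes "d \<in> orders V" "e \<in> orders W"
  shows "d + e \<in> orders (product_span V W)"
proof -
  obtain f g where f: "f \<in> V" "f \<noteq> 0" "order 0 f = d" and g: "g \<in> W" "g \<noteq> 0" "order 0 g = e"
    using assms by (metis ordersE)
  then have "f * g \<in> product_span V W"
    using product_span.add_mult[OF f(1) g(1) product_span.zero] by simp
  then show ?thesis using ordersI[of "f * g"] f g by (simp add: order_mult)
qed

text \<open>
  Modules of leading forms are closed only under scaling by coefficients that lift to the ring of
  the ideals; these make up $K$.
\<close>

locale coeff_submodule =
  fixes K :: "'e::idom set" and V :: "'e poly set"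
  assumes zero: "0 \<in> V"
    and diff: "f \<in> V \<Longrightarrow> g \<in> V \<Longrightarrow> f - g \<in> V"
    and smult: "k \<in> K \<Longrightarrow> f \<in> V \<Longrightarrow> smult k f \<in> V"
    and coeff_mem: "f \<in> V \<Longrightarrow> coeff f i \<in> K"
begin

lemma add: "f \<in> V \<Longrightarrow> g \<in> V \<Longrightarrow> f + g \<in> V"
  using diff[of f "0 - g"] diff[of 0 g] zero by simp

lemma monom_dvd_if_no_order_between:
  assumes gap: "\<And>d. d \<in> orders V \<Longrightarrow> 0 < d \<Longrightarrow> k \<le> d"
    and f: "f \<in> V" "coeff f 0 = 0"
  shows "monom 1 k dvd f"
proof (cases "f = 0")
  case False
  then have "order 0 f \<noteq> 0" using f(2) coeff_order_0 by metis
  then have "k \<le> order 0 f" using gap ordersI[OF f(1) False] by simp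
  then show ?thesis using False by (simp add: monom_1_dvd_iff)
qed simp

end

locale submodule_product = V: coeff_submodule K V + W: coeff_submodule K W
  for K :: "'e::idom set" and V W :: "'e poly set" +
  fixes B :: "nat set"
  assumes support_mult: "f \<in> V \<Longrightarrow> g \<in> W \<Longrightarrow> coeff (f * g) i \<noteq> 0 \<Longrightarrow> i \<in> B"
    and monom_mem: "b \<in> B \<Longrightarrow> monom 1 b \<in> product_span V W"
    and zero_mem: "0 \<in> B"

lemma product_span_commute: "product_span A B = product_span B (A :: 'r::comm_semiring_0 set)"
proof -
  have "z \<in> product_span B A" if "z \<in> product_span A B" for z and A B :: "'r set"
    using that
  proof induction
    case (add_mult a b z)
    then show ?case using product_span.add_mult[of b B a A z] by (simp add: mult.commute)
  qed (rule product_span.zero)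
  then show ?thesis by blast
qed

lemma submodule_product_commute: "submodule_product K V W B \<Longrightarrow> submodule_product K W V B"
  unfolding submodule_product_def submodule_product_axioms_def
  by (metis mult.commute product_span_commute)

sublocale submodule_product \<subseteq> swap: submodule_product K W V B
  by (rule submodule_product_commute) (rule submodule_product_axioms)

lemma (in submodule_product) orders_add: "d \<in> orders V \<Longrightarrow> e \<in> orders W \<Longrightarrow> d + e \<in> B"
  by (elim ordersE) (metis coeff_order_0 no_zero_divisors order_mult support_mult)

lemma (in submodule_product) exists_coeff_0_eq:
  assumes "z \<in> product_span V W"
  shows "\<exists>f\<in>V. coeff f 0 = coeff z 0"
  using assms
proof induction
  case zero
  then show ?case using V.zero by (intro bexI[of _ 0]) auto
next
  case (add_mult f g z)
  then obtain h where h: "h \<in> V" "coeff h 0 = coeff z 0" by blast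
  have "smult (coeff g 0) f + h \<in> V"
    using add_mult h by (intro V.add V.smult W.coeff_mem)
  moreover have "coeff (smult (coeff g 0) f + h) 0 = coeff (f * g + z) 0"
    by (simp add: h coeff_mult_0 mult.commute)
  ultimately show ?case by blast
qed

lemma (in submodule_product) exists_coeff_0_eq_1:
  obtains f where "f \<in> V" "coeff f 0 = 1"
  using exists_coeff_0_eq[OF monom_mem[OF zero_mem]] by auto

lemma (in submodule_product) zero_mem_orders: "0 \<in> orders V"
proof -
  obtain f where f: "f \<in> V" "coeff f 0 = 1" by (rule exists_coeff_0_eq_1)
  then have "f \<noteq> 0" by auto
  moreover from this have "order 0 f = 0" using f by (simp add: order_0_eq_iff)
  ultimately show ?thesis using ordersI[OF f(1)] by simp
qed

lemma (in submodule_product) orders_subset: "orders V \<subseteq> B"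
  using orders_add[OF _ swap.zero_mem_orders] by auto

text \<open>
  Up to degree $k$ every element of $V$ is a multiple of one $f_0 \in V$ with $f_0(0) = 1$,
  so an equation $Y^b = \sum_i f_i g_i$ collapses to $Y^b \equiv f_0 g$ with $g \in W$.
\<close>

lemma (in submodule_product) mem_orders_if_no_order_between:
  assumes gap: "\<And>d. d \<in> orders V \<Longrightarrow> 0 < d \<Longrightarrow> k \<le> d"
    and b: "b \<in> B" "b < k"
  shows "b \<in> orders W"
proof -
  obtain f0 where f0: "f0 \<in> V" "coeff f0 0 = 1" by (rule exists_coeff_0_eq_1)
  have "\<exists>g\<in>W. monom 1 k dvd z - f0 * g" if "z \<in> product_span V W" for z
    using that
  proof induction
    case zero
    then show ?case using W.zero by (intro bexI[of _ 0]) auto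
  next
    case (add_mult f h z)
    then obtain g where g: "g \<in> W" "monom 1 k dvd z - f0 * g" by blast
    let ?c = "coeff f 0"
    have "monom 1 k dvd f - smult ?c f0"
      using add_mult(1) f0 by (intro V.monom_dvd_if_no_order_between[OF gap])
        (auto intro: V.diff V.smult V.coeff_mem)
    then have "monom 1 k dvd (f - smult ?c f0) * h + (z - f0 * g)"
      using g(2) by (intro dvd_add dvd_mult2)
    also have "(f - smult ?c f0) * h + (z - f0 * g) = f * h + z - f0 * (smult ?c h + g)"
      by (simp add: algebra_simps)
    finally show ?case
      using add_mult g(1) V.coeff_mem by (intro bexI[of _ "smult ?c h + g"] W.add W.smult)
  qed
  then obtain g where g: "g \<in> W" "monom 1 k dvd monom 1 b - f0 * g"
    using monom_mem[OF b(1)] by blast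
  then have coeff_eq: "coeff (f0 * g) i = (if i = b then 1 else 0)" if "i < k" for i
    using that unfolding monom_1_dvd_iff' by (auto split: if_splits)
  have nz: "f0 * g \<noteq> 0" using coeff_eq[OF b(2)] by auto
  then have "order 0 (f0 * g) = b"
    using coeff_eq b(2) by (simp add: order_0_eq_iff)
  moreover have "order 0 f0 = 0" using nz f0(2) by (subst order_0_eq_iff) auto
  ultimately have "order 0 g = b" using nz by (simp add: order_mult)
  then show ?thesis using ordersI[OF g(1)] nz by auto
qed

lemma (in submodule_product) trivial_orders_if_two_elements:
  assumes "B = {0, e}"
  shows "orders V \<subseteq> {0} \<or> orders W \<subseteq> {0}"
proof (cases "e \<in> orders V")
  case True
  then have "e + d \<in> {0, e}" if "d \<in> orders W" for d
    using orders_add that assms by blast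
  then show ?thesis by fastforce
next
  case False
  then show ?thesis using orders_subset assms by blast
qed

locale three_cluster_product = submodule_product +
  fixes r c :: nat
  assumes low: "b \<in> B \<Longrightarrow> b < c \<Longrightarrow> b \<le> r"
    and high: "b \<in> B \<Longrightarrow> c < b \<Longrightarrow> c + r < b"
    and le_double_centre: "b \<in> B \<Longrightarrow> b \<le> 2 * c"
    and centre_mem: "c \<in> B"
    and exists_low: "\<exists>b\<in>B. 0 < b \<and> b < c"
    and double_radius_less: "2 * r < c"
    and double_notin: "b \<in> B \<Longrightarrow> 0 < b \<Longrightarrow> b \<le> r \<Longrightarrow> 2 * b \<notin> B"

sublocale three_cluster_product \<subseteq> swap: three_cluster_product K W V B r c
  by unfold_locales
    (use low high le_double_centre centre_mem exists_low double_radius_less double_notin in auto)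

lemma (in three_cluster_product) orders_subset_if_centre:
  assumes "c \<in> orders V"
  shows "orders W \<subseteq> {0, c}"
proof
  fix e assume e: "e \<in> orders W"
  then have "c + e \<in> B" "e \<in> B" using orders_add assms swap.orders_subset by auto
  then show "e \<in> {0, c}"
    using low[of e] high[of "c + e"] le_double_centre[of "c + e"]
    by (cases "e < c"; cases "e = 0") auto
qed

lemma (in three_cluster_product) trivial_orders_if_centre:
  assumes c: "c \<in> orders V"
  shows "orders W \<subseteq> {0}"
proof -
  have "c \<notin> orders W"
  proof
    assume "c \<in> orders W"
    then have gap: "c \<le> d" if "d \<in> orders V" "0 < d" for d
      using swap.orders_subset_if_centre that by auto
    obtain b where b: "b \<in> B" "0 < b" "b < c" using exists_low by blast
    then have "b \<in> orders W" using mem_orders_if_no_order_between[OF gap] by blast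
    then show False using orders_subset_if_centre[OF c] b by auto
  qed
  then show ?thesis using orders_subset_if_centre[OF c] by blast
qed

lemma (in three_cluster_product) exists_order_below_centre:
  assumes "c \<notin> orders V" "c \<notin> orders W"
  shows "\<exists>d\<in>orders V. 0 < d \<and> d < c"
proof (rule ccontr)
  assume "\<not> ?thesis"
  then have "Suc c \<le> d" if "d \<in> orders V" "0 < d" for d
    using that assms(1) by (metis Suc_leI linorder_neqE_nat)
  then have "c \<in> orders W"
    by (rule mem_orders_if_no_order_between) (use centre_mem in auto)
  then show False using assms(2) by simp
qed

lemma (in three_cluster_product) coeff_mult_near_centre:
  assumes h: "\<And>i. coeff h i \<noteq> 0 \<Longrightarrow> i \<in> B" "\<And>i. coeff h' i \<noteq> 0 \<Longrightarrow> i \<in> B" and "k \<le> r"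
  shows "coeff (h * h') (c + k) = coeff h c * coeff h' k + coeff h k * coeff h' c"
proof -
  have "coeff (h * h') (c + k) = (\<Sum>i\<le>c+k. coeff h i * coeff h' (c + k - i))"
    by (rule coeff_mult)
  also have "\<dots> = (\<Sum>i\<in>{c, k}. coeff h i * coeff h' (c + k - i))"
  proof (rule sum.mono_neutral_right)
    show "\<forall>i\<in>{..c + k} - {c, k}. coeff h i * coeff h' (c + k - i) = 0"
    proof (rule ballI, rule ccontr)
      fix i assume i: "i \<in> {..c + k} - {c, k}" and "coeff h i * coeff h' (c + k - i) \<noteq> 0"
      then have "i \<in> B" "c + k - i \<in> B" using h by force+
      then show False
        using low[of i] high[of i] low[of "c + k - i"] high[of "c + k - i"] i assms(3)
          double_radius_less
        by (cases "i < c"; cases "c + k - i < c"; cases "c + k - i = c"; simp; linarith)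
    qed
  qed auto
  also have "\<dots> = coeff h c * coeff h' k + coeff h k * coeff h' c"
    using assms(3) double_radius_less by auto
  finally show ?thesis .
qed

text \<open>Compares the two factorizations of $(f g)(f' g')$ in degree $c + k$.\<close>

lemma (in three_cluster_product) exchange_near_centre:
  assumes f: "f \<in> V" "f' \<in> V" and g: "g \<in> W" "g' \<in> W" and k: "k \<le> r"
  shows "coeff (f * g) c * coeff (f' * g') k + coeff (f * g) k * coeff (f' * g') c
    = coeff (f * g') c * coeff (f' * g) k + coeff (f * g') k * coeff (f' * g) c"
proof -
  have expand: "coeff ((p * q) * (p' * q')) (c + k)
      = coeff (p * q) c * coeff (p' * q') k + coeff (p * q) k * coeff (p' * q') c"
    if "p \<in> V" "q \<in> W" "p' \<in> V" "q' \<in> W" for p q p' q'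
    using that k by (intro coeff_mult_near_centre) (auto intro: support_mult)
  have "(f * g) * (f' * g') = (f * g') * (f' * g)" by (simp add: ac_simps)
  then show ?thesis using expand[of f g f' g'] expand[of f g' f' g] f g by metis
qed

lemma (in three_cluster_product) coeff_centre_eq_0:
  assumes f0: "f0 \<in> V" "coeff f0 0 \<noteq> 0" and g0: "g0 \<in> W" "coeff g0 0 \<noteq> 0"
    and d: "d \<in> orders V" "0 < d" and e: "e \<in> orders W" "e < c" and "d < e"
  shows "coeff (f0 * g0) c = 0"
proof -
  obtain f1 where f1: "f1 \<in> V" "f1 \<noteq> 0" "order 0 f1 = d" using d(1) by (rule ordersE)
  obtain g1 where g1: "g1 \<in> W" "g1 \<noteq> 0" "order 0 g1 = e" using e(1) by (rule ordersE)
  have nz: "f0 \<noteq> 0" "g0 \<noteq> 0" using f0(2) g0(2) by auto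
  then have order_0: "order 0 f0 = 0" "order 0 g0 = 0"
    using f0(2) g0(2) by (simp_all add: order_0_eq_iff)
  have "e \<le> r" using e swap.orders_subset low by auto
  then have "d + e \<le> r"
    using orders_add[OF d(1) e(1)] low[of "d + e"] \<open>d < e\<close> double_radius_less by simp
  have low_coeffs: "coeff (p * q) (order 0 p + order 0 q) \<noteq> 0"
      "i < order 0 p + order 0 q \<Longrightarrow> coeff (p * q) i = 0"
    if "p \<noteq> 0" "q \<noteq> 0" for i and p q :: "'a poly"
    using that coeff_order_0[of "p * q"] coeff_below_order_0[of i "p * q"]
    by (simp_all add: order_mult)
  note products = low_coeffs[OF nz] low_coeffs[OF nz(1) g1(2)] low_coeffs[OF f1(2) nz(2)]
    low_coeffs[OF f1(2) g1(2)]
  note products = products[unfolded order_0 f1(3) g1(3) add_0_left add_0_right]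
  note exchange = exchange_near_centre[OF f0(1) f1(1) g0(1) g1(1)]
  have f1g1: "coeff (f1 * g1) c = 0"
    using exchange[of 0] products d(2) \<open>d < e\<close> by auto
  have f0g1: "coeff (f0 * g1) c = 0"
    using exchange[of d] products d(2) \<open>d < e\<close> \<open>e \<le> r\<close> f1g1 by auto
  have f1g0: "coeff (f1 * g0) c = 0"
    using exchange[of e] products d(2) \<open>d < e\<close> \<open>e \<le> r\<close> f1g1 f0g1 by auto
  show ?thesis
    using exchange[of "d + e"] products \<open>d + e \<le> r\<close> f1g1 f0g1 f1g0 by auto
qed

lemma (in three_cluster_product) exists_coeff_centre_nonzero:
  "\<exists>f\<in>V. \<exists>g\<in>W. coeff f 0 \<noteq> 0 \<and> coeff g 0 \<noteq> 0 \<and> coeff (f * g) c \<noteq> 0"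
proof (rule ccontr)
  assume "\<not> ?thesis"
  then have eq_0_if_both: "coeff (f * g) c = 0"
    if "f \<in> V" "g \<in> W" "coeff f 0 \<noteq> 0" "coeff g 0 \<noteq> 0" for f g
    using that by blast
  obtain f0 where f0: "f0 \<in> V" "coeff f0 0 = 1" by (rule exists_coeff_0_eq_1)
  obtain g0 where g0: "g0 \<in> W" "coeff g0 0 = 1" by (rule swap.exists_coeff_0_eq_1)
  have eq_0_if_right: "coeff (f * g) c = 0" if "f \<in> V" "g \<in> W" "coeff g 0 \<noteq> 0" for f g
  proof (cases "coeff f 0 = 0")
    case True
    then have "coeff ((f0 + f) * g) c = 0" using that f0 by (intro eq_0_if_both) (auto intro: V.add)
    then show ?thesis using eq_0_if_both[of f0 g] f0 that by (simp add: distrib_right)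
  qed (use eq_0_if_both that in auto)
  have "coeff (f * g) c = 0" if "f \<in> V" "g \<in> W" for f g
  proof (cases "coeff g 0 = 0")
    case True
    then have "coeff (f * (g0 + g)) c = 0" using that g0 by (intro eq_0_if_right) (auto intro: W.add)
    then show ?thesis using eq_0_if_right[of f g0] g0 that by (simp add: distrib_left)
  qed (use eq_0_if_right that in auto)
  then have "coeff (monom 1 c) c = (0 :: 'a)"
    by (rule additive_product_span_eq_0[where h = "\<lambda>p. coeff p c", rotated])
      (use monom_mem[OF centre_mem] in \<open>auto simp: additive_def\<close>)
  then show False by simp
qed

lemma (in three_cluster_product) trivial_orders: "orders V \<subseteq> {0} \<or> orders W \<subseteq> {0}"
proof (rule ccontr)
  assume "\<not> ?thesis"
  then have centre: "c \<notin> orders V" "c \<notin> orders W"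
    using trivial_orders_if_centre swap.trivial_orders_if_centre by blast+
  obtain d where d: "d \<in> orders V" "0 < d" "d < c"
    using exists_order_below_centre[OF centre] by blast
  obtain e where e: "e \<in> orders W" "0 < e" "e < c"
    using swap.exists_order_below_centre[OF centre(2,1)] by blast
  have "d \<in> B" using d(1) orders_subset by blast
  then have "d \<noteq> e"
    using double_notin[of d] low[of d] d orders_add[OF d(1) e(1)] by (auto simp: mult_2)
  then have "coeff (f * g) c = 0"
    if "f \<in> V" "coeff f 0 \<noteq> 0" "g \<in> W" "coeff g 0 \<noteq> 0" for f g
    using coeff_centre_eq_0[OF that d(1,2) e(1,3)]
      swap.coeff_centre_eq_0[OF that(3,4,1,2) e(1,2) d(1,3)]
    by (cases "d < e") (auto simp: mult.commute)
  then show False using exists_coeff_centre_nonzero by blast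
qed

section \<open>Leading forms of ideals\<close>

locale form_grading =
  fixes \<pi> :: "'r::comm_ring_1 \<Rightarrow> 'e::idom poly poly" and X Y :: 'r
  assumes map_add: "\<pi> (f + g) = \<pi> f + \<pi> g"
    and map_mult: "\<pi> (f * g) = \<pi> f * \<pi> g"
    and map_eq_0: "\<pi> f = 0 \<Longrightarrow> f = 0"
    and map_X: "\<pi> X = monom 1 1"
    and map_Y: "\<pi> Y = monom (monom 1 1) 1"
    and degree_form: "degree (coeff (\<pi> f) d) \<le> d"
    and coeff_lift: "\<exists>r. \<pi> r = [:[:coeff (coeff (\<pi> f) d) j:]:]"
    and mem_ideal_XY: "coeff (\<pi> f) 0 = 0 \<Longrightarrow> f \<in> ideal_gen {X, Y}"
begin

sublocale map: additive \<pi>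
  by unfold_locales (rule map_add)

lemma map_one: "\<pi> 1 = 1"
proof -
  have "\<pi> X * \<pi> 1 = \<pi> X * 1" by (simp flip: map_mult)
  moreover have "\<pi> X \<noteq> 0" by (simp add: map_X)
  ultimately show ?thesis by (metis mult_left_cancel)
qed

lemma map_power: "\<pi> (f ^ k) = \<pi> f ^ k"
  by (induction k) (simp_all add: map_one map_mult)

lemma map_monomial: "\<pi> (X ^ i * Y ^ j) = monom (monom 1 j) (i + j)"
  by (simp add: map_mult map_power map_X map_Y monom_power mult_monom)

lemma nz_ideal_iff: "nz_ideal A \<longleftrightarrow> is_ideal A \<and> (\<exists>f\<in>A. \<pi> f \<noteq> 0)"
  unfolding nz_ideal_def using map_eq_0 map.zero is_ideal_0[of A] by auto

lemma nz_ideal_UNIV: "nz_ideal (UNIV :: 'r set)"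
  unfolding nz_ideal_iff using map_one by (intro conjI is_ideal_UNIV bexI[of _ 1]) simp_all

lemma nz_ideal_ideal_mult:
  fixes A B :: "'r set"
  assumes "nz_ideal A" "nz_ideal B"
  shows "nz_ideal (ideal_mult A B)"
proof -
  obtain f g where "f \<in> A" "\<pi> f \<noteq> 0" "g \<in> B" "\<pi> g \<noteq> 0"
    using assms by (auto simp: nz_ideal_iff)
  then have "f * g \<in> ideal_mult A B" "\<pi> (f * g) \<noteq> 0"
    by (simp_all add: mult_mem_ideal_mult map_mult)
  then show ?thesis using is_ideal_ideal_mult nz_ideal_iff by blast
qed

lemma nz_ideal_ideal_prod: "(\<And>J :: 'r set. J \<in> set Js \<Longrightarrow> nz_ideal J) \<Longrightarrow> nz_ideal (ideal_prod Js)"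
  by (induction Js) (simp_all add: ideal_prod_Nil ideal_prod_Cons nz_ideal_UNIV nz_ideal_ideal_mult)

definition lead_deg :: "'r set \<Rightarrow> nat" where
  "lead_deg A = (LEAST d. \<exists>f\<in>A. coeff (\<pi> f) d \<noteq> 0)"

definition lead_forms :: "'r set \<Rightarrow> 'e poly set" where
  "lead_forms A = (\<lambda>f. coeff (\<pi> f) (lead_deg A)) ` A"

definition const_coeffs :: "'e set" where
  "const_coeffs = {e. \<exists>r. \<pi> r = [:[:e:]:]}"

lemma coeff_below_lead_deg: "f \<in> A \<Longrightarrow> d < lead_deg A \<Longrightarrow> coeff (\<pi> f) d = 0"
  unfolding lead_deg_def using not_less_Least by blast

lemma lead_deg_eqI:
  assumes "f \<in> A" "coeff (\<pi> f) d \<noteq> 0" "\<And>g i. g \<in> A \<Longrightarrow> i < d \<Longrightarrow> coeff (\<pi> g) i = 0"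
  shows "lead_deg A = d"
  unfolding lead_deg_def
proof (rule Least_equality)
  show "\<exists>f\<in>A. coeff (\<pi> f) d \<noteq> 0" using assms by blast
  show "d \<le> i" if "\<exists>f\<in>A. coeff (\<pi> f) i \<noteq> 0" for i
    using that assms(3) by (meson linorder_not_le)
qed

lemma exists_coeff_lead_deg_nonzero:
  assumes "nz_ideal A"
  shows "\<exists>f\<in>A. coeff (\<pi> f) (lead_deg A) \<noteq> 0"
proof -
  have "\<exists>d. \<exists>f\<in>A. coeff (\<pi> f) d \<noteq> 0"
    using assms unfolding nz_ideal_iff by (metis leading_coeff_0_iff)
  then show ?thesis unfolding lead_deg_def by (rule LeastI_ex)
qed

lemma lead_formsI: "f \<in> A \<Longrightarrow> coeff (\<pi> f) (lead_deg A) \<in> lead_forms A"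
  by (simp add: lead_forms_def)

lemma lead_formsE:
  assumes "v \<in> lead_forms A"
  obtains f where "f \<in> A" "v = coeff (\<pi> f) (lead_deg A)"
  using assms by (auto simp: lead_forms_def)

lemma degree_lead_form: "v \<in> lead_forms A \<Longrightarrow> degree v \<le> lead_deg A"
  by (auto simp: lead_forms_def degree_form)

lemma coeff_submodule_lead_forms:
  assumes A: "is_ideal A"
  shows "coeff_submodule const_coeffs (lead_forms A)"
proof
  show "0 \<in> lead_forms A"
    using lead_formsI[OF is_ideal_0[OF A]] by (simp add: map.zero)
next
  fix v w assume "v \<in> lead_forms A" "w \<in> lead_forms A"
  then obtain f g where "f \<in> A" "v = coeff (\<pi> f) (lead_deg A)"
      "g \<in> A" "w = coeff (\<pi> g) (lead_deg A)"
    by (metis lead_formsE)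
  then show "v - w \<in> lead_forms A"
    using lead_formsI[of "f - g" A] A by (simp add: map.diff is_ideal_diff)
next
  fix k v assume "k \<in> const_coeffs" "v \<in> lead_forms A"
  then obtain r f where "\<pi> r = [:[:k:]:]" "f \<in> A" "v = coeff (\<pi> f) (lead_deg A)"
    by (auto simp: const_coeffs_def elim: lead_formsE)
  then show "smult k v \<in> lead_forms A"
    using lead_formsI[of "r * f" A] A by (simp add: map_mult is_ideal_mult_left)
next
  show "coeff v i \<in> const_coeffs" if "v \<in> lead_forms A" for v i
    using that coeff_lift by (auto simp: lead_forms_def const_coeffs_def)
qed

lemma coeff_map_mult_lead_deg:
  "f \<in> A \<Longrightarrow> g \<in> B \<Longrightarrow> coeff (\<pi> (f * g)) (lead_deg A + lead_deg B)
    = coeff (\<pi> f) (lead_deg A) * coeff (\<pi> g) (lead_deg B)"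
  unfolding map_mult by (rule coeff_mult_initial(2)) (auto intro: coeff_below_lead_deg)

lemma lead_deg_ideal_mult:
  assumes "nz_ideal A" "nz_ideal B"
  shows "lead_deg (ideal_mult A B) = lead_deg A + lead_deg B"
proof -
  obtain f g where f: "f \<in> A" "coeff (\<pi> f) (lead_deg A) \<noteq> 0"
    and g: "g \<in> B" "coeff (\<pi> g) (lead_deg B) \<noteq> 0"
    using assms exists_coeff_lead_deg_nonzero by metis
  show ?thesis
  proof (rule lead_deg_eqI)
    show "f * g \<in> ideal_mult A B" using f g by (intro mult_mem_ideal_mult)
    show "coeff (\<pi> (f * g)) (lead_deg A + lead_deg B) \<noteq> 0"
      using f g by (simp add: coeff_map_mult_lead_deg)
  next
    fix z i assume z: "z \<in> ideal_mult A B" and i: "i < lead_deg A + lead_deg B"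
    have "additive (\<lambda>z. coeff (\<pi> z) i)" by (simp add: additive_def map_add)
    moreover have "coeff (\<pi> (f * g)) i = 0" if "f \<in> A" "g \<in> B" for f g
      unfolding map_mult
      by (rule coeff_mult_initial(1)[OF _ _ i]) (use that in \<open>auto intro: coeff_below_lead_deg\<close>)
    moreover have "z \<in> product_span A B"
      using z assms(1) by (simp add: nz_ideal_def ideal_mult_eq_product_span)
    ultimately show "coeff (\<pi> z) i = 0" by (rule additive_product_span_eq_0)
  qed
qed

lemma lead_forms_ideal_mult:
  assumes A: "nz_ideal A" and B: "nz_ideal B"
  shows "lead_forms (ideal_mult A B) = product_span (lead_forms A) (lead_forms B)"
proof -
  have AB: "ideal_mult A B = product_span A B"
    using A by (simp add: nz_ideal_def ideal_mult_eq_product_span)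
  have coeff_step: "coeff (\<pi> (f * g + z)) (lead_deg (ideal_mult A B))
      = coeff (\<pi> f) (lead_deg A) * coeff (\<pi> g) (lead_deg B)
        + coeff (\<pi> z) (lead_deg (ideal_mult A B))"
    if "f \<in> A" "g \<in> B" for f g z
    using coeff_map_mult_lead_deg[OF that] by (simp add: lead_deg_ideal_mult[OF A B] map_add)
  have "coeff (\<pi> z) (lead_deg (ideal_mult A B)) \<in> product_span (lead_forms A) (lead_forms B)"
    if "z \<in> product_span A B" for z
    using that
  proof induction
    case zero
    then show ?case by (simp add: map.zero product_span.zero)
  next
    case (add_mult f g z)
    then show ?case by (simp add: coeff_step product_span.add_mult lead_formsI)
  qed
  moreover have "u \<in> lead_forms (ideal_mult A B)"
    if "u \<in> product_span (lead_forms A) (lead_forms B)" for u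
    using that
  proof induction
    case zero
    then show ?case
      using lead_formsI[OF is_ideal_0[OF is_ideal_ideal_mult]] by (simp add: map.zero)
  next
    case (add_mult v w u)
    then obtain f g z where "f \<in> A" "v = coeff (\<pi> f) (lead_deg A)"
        "g \<in> B" "w = coeff (\<pi> g) (lead_deg B)"
        "z \<in> ideal_mult A B" "u = coeff (\<pi> z) (lead_deg (ideal_mult A B))"
      by (metis lead_formsE)
    then show ?case
      using lead_formsI[of "f * g + z" "ideal_mult A B"] coeff_step
      by (simp add: AB product_span.add_mult)
  qed
  ultimately show ?thesis by (auto simp: AB elim: lead_formsE)
qed

lemma zero_mem_orders_lead_forms_UNIV: "0 \<in> orders (lead_forms UNIV)"
proof -
  have "lead_deg UNIV = 0" by (rule lead_deg_eqI[of 1]) (auto simp: map_one)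
  then have "1 \<in> lead_forms UNIV" using lead_formsI[of 1 UNIV] by (simp add: map_one)
  then show ?thesis using ordersI[of 1] by force
qed

lemma sum_mem_orders_lead_forms_ideal_prod:
  assumes "\<And>i. i < length Js \<Longrightarrow> nz_ideal (Js ! i) \<and> d i \<in> orders (lead_forms (Js ! i))"
  shows "(\<Sum>i<length Js. d i) \<in> orders (lead_forms (ideal_prod Js))"
  using assms
proof (induction Js arbitrary: d)
  case Nil
  then show ?case by (simp add: ideal_prod_Nil zero_mem_orders_lead_forms_UNIV)
next
  case (Cons J Js)
  have J: "nz_ideal J" "d 0 \<in> orders (lead_forms J)" using Cons.prems[of 0] by auto
  have Js: "nz_ideal (Js ! i) \<and> d (Suc i) \<in> orders (lead_forms (Js ! i))" if "i < length Js" for i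
    using Cons.prems[of "Suc i"] that by simp
  then have "nz_ideal (ideal_prod Js)"
    by (intro nz_ideal_ideal_prod) (auto simp: in_set_conv_nth)
  moreover have "(\<Sum>i<length Js. d (Suc i)) \<in> orders (lead_forms (ideal_prod Js))"
    using Js by (rule Cons.IH)
  ultimately show ?case
    using orders_product_span_add J
    by (simp add: ideal_prod_Cons lead_forms_ideal_mult sum.lessThan_Suc_shift
        del: sum.lessThan_Suc)
qed

end

section \<open>Monomial ideals\<close>

context form_grading
begin

definition mono_ideal :: "nat \<Rightarrow> nat set \<Rightarrow> 'r set" where
  "mono_ideal m B = ideal_gen ((\<lambda>b. X ^ (m - b) * Y ^ b) ` B)"

lemma is_ideal_mono_ideal: "is_ideal (mono_ideal m B)"
  by (simp add: mono_ideal_def is_ideal_ideal_gen)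

lemma monomial_mem_mono_ideal: "b \<in> B \<Longrightarrow> X ^ (m - b) * Y ^ b \<in> mono_ideal m B"
  unfolding mono_ideal_def by (intro ideal_gen_base imageI)

lemma mono_ideal_mult:
  assumes "B \<subseteq> {..m}" "C \<subseteq> {..k}"
  shows "ideal_mult (mono_ideal m B) (mono_ideal k C) = mono_ideal (m + k) (B + C)"
proof -
  have monomial_mult:
    "X ^ (m + k - (b + c)) * Y ^ (b + c) = (X ^ (m - b) * Y ^ b) * (X ^ (k - c) * Y ^ c)"
    if "b \<in> B" "c \<in> C" for b c
  proof -
    have "b \<le> m" "c \<le> k" using that assms by auto
    then have "m + k - (b + c) = (m - b) + (k - c)" by simp
    then show ?thesis by (simp add: power_add ac_simps)
  qed
  have "(\<lambda>b. X ^ (m - b) * Y ^ b) ` B * (\<lambda>c. X ^ (k - c) * Y ^ c) ` C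
      = (\<lambda>(b, c). (X ^ (m - b) * Y ^ b) * (X ^ (k - c) * Y ^ c)) ` (B \<times> C)"
    by (auto simp: set_times_image image_iff)
  also have "\<dots> = (\<lambda>(b, c). X ^ (m + k - (b + c)) * Y ^ (b + c)) ` (B \<times> C)"
    using monomial_mult by (intro image_cong) auto
  also have "\<dots> = (\<lambda>b. X ^ (m + k - b) * Y ^ b) ` (B + C)"
    by (simp add: set_plus_image image_image case_prod_unfold)
  finally show ?thesis
    unfolding mono_ideal_def ideal_mult_ideal_gen_left ideal_mult_ideal_gen_right
    by (simp add: ideal_mult_eq)
qed

lemma coeffs_mono_ideal:
  assumes B: "B \<subseteq> {..m}" and f: "f \<in> mono_ideal m B"
  shows "d < m \<Longrightarrow> coeff (\<pi> f) d = 0" and "coeff (coeff (\<pi> f) m) j \<noteq> 0 \<Longrightarrow> j \<in> B"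
proof -
  let ?P = "\<lambda>f. (\<forall>d<m. coeff (\<pi> f) d = 0) \<and> (\<forall>j. j \<notin> B \<longrightarrow> coeff (coeff (\<pi> f) m) j = 0)"
  have "f \<in> ideal.span ((\<lambda>b. X ^ (m - b) * Y ^ b) ` B)"
    using f by (simp add: mono_ideal_def ideal_gen_eq_span)
  then have "?P f"
  proof (induction rule: ideal.span_induct_alt)
    case base
    then show ?case by (simp add: map.zero)
  next
    case (step r p z)
    then obtain b where b: "b \<in> B" "\<pi> p = monom (monom 1 b) m"
      using B by (auto simp: map_monomial)
    have "coeff (\<pi> (r * p + z)) d = coeff (\<pi> z) d" if "d < m" for d
      using that by (simp add: map_add map_mult b(2) coeff_monom_mult mult.commute[of "\<pi> r"])
    moreover have "coeff (\<pi> (r * p + z)) m = monom 1 b * coeff (\<pi> r) 0 + coeff (\<pi> z) m"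
      by (simp add: map_add map_mult b(2) coeff_monom_mult mult.commute[of "\<pi> r"])
    moreover have "coeff (monom 1 b * coeff (\<pi> r) 0) j = 0" if "j \<notin> B" for j
      using that b(1) degree_form[of r 0]
      by (cases "j = b") (auto simp: coeff_monom_mult intro!: coeff_eq_0)
    ultimately show ?case using step.IH by simp
  qed
  then show "d < m \<Longrightarrow> coeff (\<pi> f) d = 0" and "coeff (coeff (\<pi> f) m) j \<noteq> 0 \<Longrightarrow> j \<in> B" by auto
qed

lemma lead_deg_mono_ideal:
  assumes "B \<subseteq> {..m}" "b \<in> B"
  shows "lead_deg (mono_ideal m B) = m"
proof (rule lead_deg_eqI[OF monomial_mem_mono_ideal[OF assms(2)]])
  show "coeff (\<pi> (X ^ (m - b) * Y ^ b)) m \<noteq> 0"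
    using assms by (auto simp: map_monomial)
qed (rule coeffs_mono_ideal(1)[OF assms(1)])

lemma monom_mem_lead_forms_mono_ideal:
  assumes "B \<subseteq> {..m}" "b \<in> B"
  shows "monom 1 b \<in> lead_forms (mono_ideal m B)"
proof -
  have "b \<le> m" using assms by auto
  then show ?thesis
    using lead_formsI[OF monomial_mem_mono_ideal[OF assms(2)], of m]
    by (simp add: lead_deg_mono_ideal[OF assms] map_monomial)
qed

lemma support_lead_forms_mono_ideal:
  assumes "B \<subseteq> {..m}" "v \<in> lead_forms (mono_ideal m B)" "coeff v i \<noteq> 0"
  shows "i \<in> B"
proof (cases "B = {}")
  case True
  then have "mono_ideal m B = {0}" by (simp add: mono_ideal_def ideal_gen_eq_span)
  then show ?thesis using assms(2,3) by (auto simp: lead_forms_def map.zero)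
next
  case False
  then have "lead_deg (mono_ideal m B) = m" using lead_deg_mono_ideal assms(1) by blast
  then show ?thesis using assms coeffs_mono_ideal(2) by (auto simp: lead_forms_def)
qed

lemma orders_lead_forms_mono_ideal:
  assumes "B \<subseteq> {..m}"
  shows "orders (lead_forms (mono_ideal m B)) \<subseteq> B"
  using support_lead_forms_mono_ideal[OF assms _ coeff_order_0] by (auto simp: orders_def)

lemma nz_ideal_mono_ideal:
  assumes "b \<in> B"
  shows "nz_ideal (mono_ideal m B)"
  unfolding nz_ideal_iff using monomial_mem_mono_ideal[OF assms, of m]
  by (intro conjI is_ideal_mono_ideal bexI) (simp_all add: map_monomial)

lemma mono_ideal_neq_UNIV:
  assumes "B \<subseteq> {..m}" "0 < m"
  shows "mono_ideal m B \<noteq> UNIV"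
  using coeffs_mono_ideal(1)[OF assms(1) _ assms(2), of 1] by (auto simp: map_one)

lemma mono_ideal_0: "mono_ideal 0 {0} = UNIV"
  using monomial_mem_mono_ideal[of 0 "{0}" 0]
  by (simp add: is_ideal_eq_UNIV_iff is_ideal_mono_ideal)

end

locale mono_ideal_factorization = form_grading +
  fixes m :: nat and B :: "nat set" and I J :: "'a set"
  assumes bounded: "B \<subseteq> {..m}" and bot_mem: "0 \<in> B" and top_mem: "m \<in> B"
    and ideals: "is_ideal I" "is_ideal J"
    and factorization: "ideal_mult I J = mono_ideal m B"

lemma (in mono_ideal_factorization) commuted: "mono_ideal_factorization \<pi> X Y m B J I"
  by unfold_locales
    (use bounded bot_mem top_mem ideals factorization in \<open>simp_all add: ideal_mult_commute\<close>)

lemma (in mono_ideal_factorization) nz_ideal_left: "nz_ideal I"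
proof -
  have "mono_ideal m B \<subseteq> I" using ideal_mult_subset_left[OF ideals(1)] factorization by blast
  then show ?thesis using nz_ideal_mono_ideal[OF bot_mem] ideals(1) unfolding nz_ideal_iff by blast
qed

lemma (in mono_ideal_factorization) nz_ideal_right: "nz_ideal J"
  by (rule mono_ideal_factorization.nz_ideal_left[OF commuted])

lemma (in mono_ideal_factorization) submodule_product_lead_forms:
  "submodule_product const_coeffs (lead_forms I) (lead_forms J) B"
proof -
  have product: "product_span (lead_forms I) (lead_forms J) = lead_forms (mono_ideal m B)"
    using lead_forms_ideal_mult[OF nz_ideal_left nz_ideal_right] by (simp add: factorization)
  interpret V: coeff_submodule const_coeffs "lead_forms I"
    by (rule coeff_submodule_lead_forms[OF ideals(1)])
  interpret W: coeff_submodule const_coeffs "lead_forms J"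
    by (rule coeff_submodule_lead_forms[OF ideals(2)])
  show "submodule_product const_coeffs (lead_forms I) (lead_forms J) B"
  proof unfold_locales
    show "i \<in> B" if "v \<in> lead_forms I" "w \<in> lead_forms J" "coeff (v * w) i \<noteq> 0" for v w i
    proof -
      have "v * w \<in> lead_forms (mono_ideal m B)"
        using product_span.add_mult[OF that(1,2) product_span.zero] by (simp add: product)
      then show ?thesis using that(3) by (rule support_lead_forms_mono_ideal[OF bounded])
    qed
    show "monom 1 b \<in> product_span (lead_forms I) (lead_forms J)" if "b \<in> B" for b
      unfolding product using monom_mem_lead_forms_mono_ideal[OF bounded that] .
  qed (rule bot_mem)
qed

sublocale mono_ideal_factorization \<subseteq> submodule_product const_coeffs "lead_forms I" "lead_forms J" B
  by (rule submodule_product_lead_forms)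

text \<open>
  If all orders of $I$ vanish, then $m$ is an order of $J$, so $I$ has an element with constant
  leading form 1. It is a unit modulo the radical of $I$, which contains $X$ and $Y$.
\<close>

lemma (in mono_ideal_factorization) eq_UNIV_if_trivial_orders:
  assumes trivial: "orders (lead_forms I) \<subseteq> {0}"
  shows "I = UNIV"
proof -
  have "m \<in> orders (lead_forms J)"
    by (rule mem_orders_if_no_order_between[of "Suc m"]) (use trivial top_mem in auto)
  then obtain w where "w \<in> lead_forms J" "w \<noteq> 0" "order 0 w = m" by (rule ordersE)
  then have "m \<le> lead_deg J" using order_degree[of w 0] degree_lead_form[of w J] by simp
  moreover have "lead_deg I + lead_deg J = m"
    using lead_deg_ideal_mult[OF nz_ideal_left nz_ideal_right]
    by (simp add: factorization lead_deg_mono_ideal[OF bounded bot_mem])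
  ultimately have lead_deg_0: "lead_deg I = 0" by simp
  obtain v where v: "v \<in> lead_forms I" "coeff v 0 = 1" by (rule exists_coeff_0_eq_1)
  then obtain f where f: "f \<in> I" "v = coeff (\<pi> f) 0" by (auto simp: lead_forms_def lead_deg_0)
  have "degree v = 0" using degree_form[of f 0] f(2) by simp
  then have "v = 1" using v(2) by (auto simp: one_pCons elim: degree_eq_zeroE)
  then have "coeff (\<pi> (1 - f)) 0 = 0" using f(2) by (simp add: map.diff map_one)
  then have "1 - f \<in> ideal_gen {X, Y}" by (rule mem_ideal_XY)
  moreover have "ideal_gen {X, Y} \<subseteq> radical I"
  proof (rule ideal_gen_minimal)
    have "mono_ideal m B \<subseteq> I" using ideal_mult_subset_left[OF ideals(1)] factorization by blast
    then have "X ^ m \<in> I" "Y ^ m \<in> I"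
      using monomial_mem_mono_ideal[OF bot_mem, of m] monomial_mem_mono_ideal[OF top_mem, of m]
      by auto
    then show "{X, Y} \<subseteq> radical I" by (auto simp: radical_def)
  qed (rule is_ideal_radical[OF ideals(1)])
  ultimately show ?thesis using is_ideal_eq_UNIV_if_unit_mod_radical[OF ideals(1) f(1)] by blast
qed

lemma (in form_grading) ideal_atom_mono_idealI:
  assumes B: "B \<subseteq> {..m}" "0 \<in> B" "m \<in> B" and "0 < m"
    and trivial: "\<And>V W. submodule_product const_coeffs V W B \<Longrightarrow> orders V \<subseteq> {0} \<or> orders W \<subseteq> {0}"
  shows "ideal_atom (mono_ideal m B)"
  unfolding ideal_atom_def
proof (intro conjI allI impI)
  fix I J assume "nz_ideal I" "nz_ideal J" "mono_ideal m B = ideal_mult I J"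
  then interpret mono_ideal_factorization \<pi> X Y m B I J
    by unfold_locales (use B in \<open>simp_all add: nz_ideal_def\<close>)
  show "I = UNIV \<or> J = UNIV"
    using trivial[OF submodule_product_axioms] eq_UNIV_if_trivial_orders
      mono_ideal_factorization.eq_UNIV_if_trivial_orders[OF commuted] by blast
next
  show "nz_ideal (mono_ideal m B)" by (rule nz_ideal_mono_ideal[OF B(2)])
  show "mono_ideal m B \<noteq> UNIV" by (rule mono_ideal_neq_UNIV[OF B(1) \<open>0 < m\<close>])
qed

lemma (in form_grading) ideal_atom_mono_ideal_two:
  assumes "0 < e"
  shows "ideal_atom (mono_ideal e {0, e})"
proof (rule ideal_atom_mono_idealI)
  show "orders V \<subseteq> {0} \<or> orders W \<subseteq> {0}" if "submodule_product const_coeffs V W {0, e}" for V W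
    using submodule_product.trivial_orders_if_two_elements[OF that refl] .
qed (use assms in auto)

lemma (in form_grading) ideal_lengths_mono_ideal_subset_sums:
  assumes B: "B \<subseteq> {..m}" "0 \<in> B" "m \<in> B" and k: "k \<in> ideal_lengths (mono_ideal m B)"
  obtains s where "\<And>i. i < k \<Longrightarrow> 0 < s i" and "\<And>K. K \<subseteq> {..<k} \<Longrightarrow> (\<Sum>i\<in>K. s i) \<in> B"
proof -
  obtain Js where Js: "length Js = k" "\<forall>J\<in>set Js. ideal_atom J" "ideal_prod Js = mono_ideal m B"
    using k by (auto simp: ideal_lengths_def)
  have atoms: "nz_ideal (Js ! i)" "Js ! i \<noteq> UNIV" if "i < k" for i
    using Js that by (auto simp: ideal_atom_def)
  have orders: "0 \<in> orders (lead_forms (Js ! i)) \<and> (\<exists>d\<in>orders (lead_forms (Js ! i)). 0 < d)"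
    if "i < k" for i
  proof -
    have "Js ! i \<in> set Js" using that Js(1) by simp
    then obtain J' where "is_ideal J'" "ideal_prod Js = ideal_mult (Js ! i) J'"
      by (rule ideal_prod_split_factor)
    then interpret mono_ideal_factorization \<pi> X Y m B "Js ! i" J'
      by unfold_locales (use B Js(3) atoms(1)[OF that] in \<open>simp_all add: nz_ideal_def\<close>)
    have "\<not> orders (lead_forms (Js ! i)) \<subseteq> {0}"
      using eq_UNIV_if_trivial_orders atoms(2)[OF that] by blast
    then show ?thesis using zero_mem_orders by auto
  qed
  then obtain s where s: "\<And>i. i < k \<Longrightarrow> s i \<in> orders (lead_forms (Js ! i)) \<and> 0 < s i"
    by metis
  show thesis
  proof (rule that)
    show "0 < s i" if "i < k" for i using s[OF that] by simp
    show "(\<Sum>i\<in>K. s i) \<in> B" if "K \<subseteq> {..<k}" for K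
    proof -
      have "(\<Sum>i<length Js. if i \<in> K then s i else 0) \<in> orders (lead_forms (ideal_prod Js))"
        using s orders atoms(1) Js(1) by (intro sum_mem_orders_lead_forms_ideal_prod) simp
      moreover have "(\<Sum>i<length Js. if i \<in> K then s i else 0) = (\<Sum>i\<in>K. s i)"
        using that by (simp add: Js(1) sum.If_cases Int_absorb1)
      ultimately show ?thesis using orders_lead_forms_mono_ideal[OF B(1)] Js(3) by auto
    qed
  qed
qed

section \<open>Subset sums\<close>

definition subset_sums :: "(nat \<Rightarrow> nat) \<Rightarrow> nat \<Rightarrow> nat set" where
  "subset_sums a j = sum a ` Pow {1..j}"

lemma subset_sums_0: "subset_sums a 0 = {0}"
  by (simp add: subset_sums_def)

lemma subset_sums_Suc: "subset_sums a (Suc j) = subset_sums a j + {0, a (Suc j)}"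
proof -
  have "sum a (insert (Suc j) I) = sum a I + a (Suc j)" if "I \<in> Pow {1..j}" for I
  proof -
    have "finite I" "Suc j \<notin> I" using that finite_subset by auto
    then show ?thesis by simp
  qed
  then have "sum a ` insert (Suc j) ` Pow {1..j} = (\<lambda>t. t + a (Suc j)) ` subset_sums a j"
    unfolding subset_sums_def image_image by (intro image_cong) auto
  then show ?thesis
    by (auto simp: subset_sums_def atLeastAtMostSuc_conv Pow_insert image_Un set_plus_def)
qed

lemma mem_subset_sums_Suc_iff:
  "t \<in> subset_sums a (Suc j) \<longleftrightarrow> t \<in> subset_sums a j \<or> (\<exists>u\<in>subset_sums a j. t = u + a (Suc j))"
  by (auto simp: subset_sums_Suc set_plus_def)

lemma subset_sums_le: "t \<in> subset_sums a j \<Longrightarrow> t \<le> sum a {1..j}"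
  by (auto simp: subset_sums_def intro!: sum_mono2)

lemma sum_mem_subset_sums: "sum a {1..j} \<in> subset_sums a j"
  by (simp add: subset_sums_def)

lemma zero_mem_subset_sums: "0 \<in> subset_sums a j"
  by (auto simp: subset_sums_def intro!: image_eqI[of _ _ "{}"])

lemma mem_subset_sums_if_less: "t \<in> subset_sums a (Suc j) \<Longrightarrow> t < a (Suc j) \<Longrightarrow> t \<in> subset_sums a j"
  by (auto simp: mem_subset_sums_Suc_iff)

definition doubly_superincreasing :: "(nat \<Rightarrow> nat) \<Rightarrow> nat \<Rightarrow> bool" where
  "doubly_superincreasing a j \<longleftrightarrow> (\<forall>i<j. 2 * sum a {1..i} < a (Suc i))"

lemma doubly_superincreasing_SucD: "doubly_superincreasing a (Suc j) \<Longrightarrow> doubly_superincreasing a j"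
  by (simp add: doubly_superincreasing_def)

lemma doubly_superincreasing_pos: "doubly_superincreasing a j \<Longrightarrow> 1 \<le> i \<Longrightarrow> i \<le> j \<Longrightarrow> 0 < a i"
  by (cases i) (auto simp: doubly_superincreasing_def dest: spec[of _ "i - 1"])

definition level :: "(nat \<Rightarrow> nat) \<Rightarrow> nat \<Rightarrow> nat" where
  "level a t = (LEAST i. t \<le> sum a {1..i})"

lemma level_le_iff:
  assumes "t \<le> sum a {1..j}"
  shows "level a t \<le> i \<longleftrightarrow> t \<le> sum a {1..i}"
proof
  have "t \<le> sum a {1..level a t}" unfolding level_def using assms by (rule LeastI)
  moreover assume "level a t \<le> i"
  then have "sum a {1..level a t} \<le> sum a {1..i}" by (intro sum_mono2) auto
  ultimately show "t \<le> sum a {1..i}" by simp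
next
  show "t \<le> sum a {1..i} \<Longrightarrow> level a t \<le> i" unfolding level_def by (rule Least_le)
qed

lemma level_neq_if_add_mem_subset_sums:
  assumes "doubly_superincreasing a j"
    and "s \<in> subset_sums a j" "t \<in> subset_sums a j" "s + t \<in> subset_sums a j"
    and "0 < s" "0 < t"
  shows "level a s \<noteq> level a t"
  using assms
proof (induction j)
  case 0
  then show ?case by (simp add: subset_sums_0)
next
  case (Suc j)
  have gap: "2 * sum a {1..j} < a (Suc j)" using Suc.prems(1) by (simp add: doubly_superincreasing_def)
  have level_le_pred_iff: "level a u \<le> j \<longleftrightarrow> u \<in> subset_sums a j" if "u \<in> subset_sums a (Suc j)" for u
  proof -
    have "u \<in> subset_sums a j \<longleftrightarrow> u \<le> sum a {1..j}"
      using that gap subset_sums_le[of u a j] by (auto simp: mem_subset_sums_Suc_iff)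
    then show ?thesis using level_le_iff[OF subset_sums_le[OF that]] by simp
  qed
  consider (none) "s \<in> subset_sums a j" "t \<in> subset_sums a j"
    | (one) "s \<in> subset_sums a j \<longleftrightarrow> t \<notin> subset_sums a j"
    | (both) "s \<notin> subset_sums a j" "t \<notin> subset_sums a j" by blast
  then show ?case
  proof cases
    case none
    then have "s + t < a (Suc j)"
      using gap subset_sums_le[of s a j] subset_sums_le[of t a j] by simp
    then have "s + t \<in> subset_sums a j" by (rule mem_subset_sums_if_less[OF Suc.prems(4)])
    then show ?thesis
      using Suc.IH doubly_superincreasing_SucD[OF Suc.prems(1)] none Suc.prems(5,6) by simp
  next
    case one
    then show ?thesis
      using level_le_pred_iff[OF Suc.prems(2)] level_le_pred_iff[OF Suc.prems(3)] by auto
  next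
    case both
    then have "a (Suc j) \<le> s" "a (Suc j) \<le> t"
      using mem_subset_sums_if_less[OF Suc.prems(2)] mem_subset_sums_if_less[OF Suc.prems(3)] not_le
      by blast+
    moreover have "s + t \<le> sum a {1..j} + a (Suc j)"
      using subset_sums_le[OF Suc.prems(4)] by (simp add: atLeastAtMostSuc_conv)
    ultimately show ?thesis using gap by linarith
  qed
qed

lemma double_notin_subset_sums:
  "doubly_superincreasing a j \<Longrightarrow> t \<in> subset_sums a j \<Longrightarrow> 0 < t \<Longrightarrow> 2 * t \<notin> subset_sums a j"
  using level_neq_if_add_mem_subset_sums[of a j t t] by (auto simp: mult_2)

lemma card_le_if_pair_sums_mem_subset_sums:
  assumes a: "doubly_superincreasing a j"
    and s: "\<And>k. k \<in> K \<Longrightarrow> 0 < s k \<and> s k \<in> subset_sums a j"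
    and pairs: "\<And>k l. k \<in> K \<Longrightarrow> l \<in> K \<Longrightarrow> k \<noteq> l \<Longrightarrow> s k + s l \<in> subset_sums a j"
  shows "card K \<le> j"
proof -
  have "inj_on (\<lambda>k. level a (s k)) K"
    using level_neq_if_add_mem_subset_sums[OF a] s pairs by (meson inj_onI)
  moreover have "level a (s k) \<in> {1..j}" if "k \<in> K" for k
  proof -
    have s_k_le: "s k \<le> sum a {1..j}" using s[OF that] subset_sums_le by blast
    then have "\<not> level a (s k) \<le> 0" "level a (s k) \<le> j"
      unfolding level_le_iff[OF s_k_le] using s[OF that] by simp_all
    then show ?thesis by simp
  qed
  ultimately have "card K \<le> card {1..j}" by (intro card_inj_on_le[of _ K]) auto
  then show ?thesis by simp
qed

locale C1_C2_sequence =
  fixes a :: "nat \<Rightarrow> nat" and n :: nat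
  assumes two_le_n: "2 \<le> n"
    and doubly_superincreasing: "doubly_superincreasing a n"
    and a_Suc_n: "a (Suc n) = sum a {1..n-1} + 2 * a n"

lemma C1_C2_sequenceI:
  assumes "2 \<le> n" "\<forall>i\<in>{1..n+1}. 0 < a i" "a (n + 1) = sum a {1..n-1} + 2 * a n"
    and "\<forall>i\<in>{1..n-1}. 2 * sum a {1..i} < a (i + 1)"
  shows "C1_C2_sequence a n"
proof
  show "doubly_superincreasing a n"
    unfolding doubly_superincreasing_def
  proof (intro allI impI)
    show "2 * sum a {1..i} < a (Suc i)" if "i < n" for i
      using that assms(2,4) by (cases "i = 0") auto
  qed
qed (use assms in simp_all)

context C1_C2_sequence
begin

definition radius :: nat where "radius = sum a {1..n-1}"

definition centre :: nat where "centre = sum a {1..n}"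

lemma centre_eq: "centre = radius + a n"
proof -
  have "{1..n} = insert n {1..n-1}" using two_le_n by auto
  then show ?thesis using two_le_n by (simp add: centre_def radius_def)
qed

lemma doubly_superincreasing_pred: "doubly_superincreasing a (n - 1)"
  using doubly_superincreasing two_le_n doubly_superincreasing_SucD[of a "n - 1"] by simp

lemma double_radius_less: "2 * radius < a n"
  using doubly_superincreasing two_le_n
  by (auto simp: doubly_superincreasing_def radius_def dest: spec[of _ "n - 1"])

lemma radius_pos: "0 < radius"
proof -
  have "0 < a 1" using doubly_superincreasing_pos[OF doubly_superincreasing] two_le_n by simp
  moreover have "a 1 \<le> radius" unfolding radius_def using two_le_n by (intro member_le_sum) auto
  ultimately show ?thesis by simp
qed

lemma a_pos: "1 \<le> i \<Longrightarrow> i \<le> n + 1 \<Longrightarrow> 0 < a i"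
  using doubly_superincreasing_pos[OF doubly_superincreasing] double_radius_less a_Suc_n
  by (cases "i = Suc n") auto

lemma a_Suc_n_eq: "a (Suc n) = radius + 2 * a n"
  by (simp add: a_Suc_n radius_def)

lemma sum_Suc_n: "sum a {1..Suc n} = 2 * centre + a n"
  using centre_eq a_Suc_n_eq by (simp add: centre_def atLeastAtMostSuc_conv)

lemma subset_sums_n: "subset_sums a n = subset_sums a (n - 1) + {0, a n}"
  using subset_sums_Suc[of a "n - 1"] two_le_n by simp

lemma subset_sums_pred_le: "t \<in> subset_sums a (n - 1) \<Longrightarrow> t \<le> radius"
  unfolding radius_def by (rule subset_sums_le)

lemma mem_subset_sums_pred_if_less:
  assumes "t \<in> subset_sums a (Suc n)" "t < a n"
  shows "t \<in> subset_sums a (n - 1)"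
  using mem_subset_sums_if_less[OF assms(1)] assms(2) a_Suc_n_eq
  by (auto simp: subset_sums_n set_plus_def)

lemma diff_mem_subset_sums_pred:
  assumes "t \<in> subset_sums a (Suc n)" "a n \<le> t" "t < a (Suc n)"
  shows "t - a n \<in> subset_sums a (n - 1)"
  using mem_subset_sums_if_less[OF assms(1,3)] assms(2) subset_sums_pred_le double_radius_less
  by (fastforce simp: subset_sums_n set_plus_def)

end

text \<open>
  Summands below $a_n$ have distinct levels, hence there are at most $n - 1$ of them. At most three
  summands are at least $a_n$; if there are three, subtracting $a_n$ from a suitable one yields a
  further summand at a new level below $a_n$.
\<close>

locale subset_sums_family = C1_C2_sequence +
  fixes K :: "'k set" and s :: "'k \<Rightarrow> nat"
  assumes finite_K: "finite K"
    and s_pos: "k \<in> K \<Longrightarrow> 0 < s k"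
    and sums_mem: "L \<subseteq> K \<Longrightarrow> sum s L \<in> subset_sums a (Suc n)"
begin

definition large :: "'k set" where "large = {k \<in> K. a n \<le> s k}"

definition small :: "'k set" where "small = {k \<in> K. s k < a n}"

lemma finite_large: "finite large" and finite_small: "finite small"
  using finite_K by (simp_all add: large_def small_def)

lemma s_mem: "k \<in> K \<Longrightarrow> s k \<in> subset_sums a (Suc n)"
  using sums_mem[of "{k}"] by simp

lemma pair_mem: "k \<in> K \<Longrightarrow> l \<in> K \<Longrightarrow> k \<noteq> l \<Longrightarrow> s k + s l \<in> subset_sums a (Suc n)"
  using sums_mem[of "{k, l}"] by simp

lemma card_eq: "card K = card large + card small"
proof -
  have "K = large \<union> small" "large \<inter> small = {}" by (auto simp: large_def small_def)
  then show ?thesis using card_Un_disjoint[OF finite_large finite_small] by simp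
qed

lemma small_mem: "k \<in> small \<Longrightarrow> s k \<in> subset_sums a (n - 1)"
  using mem_subset_sums_pred_if_less[OF s_mem] by (simp add: small_def)

lemma small_pair_mem:
  assumes "k \<in> small" "l \<in> small" "k \<noteq> l"
  shows "s k + s l \<in> subset_sums a (n - 1)"
proof (rule mem_subset_sums_pred_if_less)
  show "s k + s l \<in> subset_sums a (Suc n)" using assms by (intro pair_mem) (auto simp: small_def)
  have "s k \<le> radius" "s l \<le> radius" using assms small_mem subset_sums_pred_le by blast+
  then show "s k + s l < a n" using double_radius_less by simp
qed

lemma card_small: "card small \<le> n - 1"
proof (rule card_le_if_pair_sums_mem_subset_sums[OF doubly_superincreasing_pred])
  show "0 < s k \<and> s k \<in> subset_sums a (n - 1)" if "k \<in> small" for k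
    using small_mem[OF that] that s_pos by (simp add: small_def)
qed (rule small_pair_mem)

lemma sum_large_le: "sum s large \<le> 2 * radius + 3 * a n"
  using subset_sums_le[OF sums_mem[of large]] unfolding sum_Suc_n by (simp add: large_def centre_eq)

lemma card_large: "card large \<le> 3"
proof -
  have "card large * a n \<le> sum s large"
    using sum_bounded_below[of large "a n" s] by (simp add: large_def)
  also have "\<dots> < 4 * a n" using sum_large_le double_radius_less by simp
  finally show ?thesis by simp
qed

lemma large_less:
  assumes "card large = 3" "k \<in> large"
  shows "s k < a (Suc n)"
proof -
  have "card (large - {k}) * a n \<le> sum s (large - {k})"
    using sum_bounded_below[of "large - {k}" "a n" s] by (simp add: large_def)
  moreover have "sum s large = s k + sum s (large - {k})"
    using finite_large assms(2) by (rule sum.remove)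
  ultimately show ?thesis
    using sum_large_le assms double_radius_less a_Suc_n_eq finite_large by simp
qed

lemma exists_large_neq:
  assumes "card large = 3"
  shows "\<exists>k\<in>large. s k \<noteq> a n"
proof (rule ccontr)
  assume all_eq: "\<not> ?thesis"
  obtain k l where kl: "k \<in> large" "l \<in> large" "k \<noteq> l"
    using assms card_le_Suc0_iff_eq[OF finite_large] by fastforce
  then have "s k + s l \<in> subset_sums a (Suc n)" by (intro pair_mem) (auto simp: large_def)
  moreover have "s k + s l = 2 * a n" using all_eq kl by simp
  ultimately have "2 * a n \<in> subset_sums a (Suc n)" by simp
  then have "a n \<in> subset_sums a (n - 1)"
    using diff_mem_subset_sums_pred[of "2 * a n"] radius_pos a_Suc_n_eq by (simp add: mult_2)
  then show False using subset_sums_pred_le double_radius_less by force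
qed

lemma card_small_if_three_large:
  assumes "card large = 3"
  shows "card small < n - 1"
proof -
  obtain k where k: "k \<in> large" "s k \<noteq> a n" using exists_large_neq[OF assms] by blast
  then have k_mem: "k \<in> K" "a n < s k" "k \<notin> small" by (auto simp: large_def small_def)
  let ?s = "s(k := s k - a n)"
  have s_k: "s k - a n \<in> subset_sums a (n - 1)"
    using k_mem large_less[OF assms k(1)] by (intro diff_mem_subset_sums_pred s_mem) auto
  have s_k_pair: "s k - a n + s l \<in> subset_sums a (n - 1)" if l: "l \<in> small" for l
  proof -
    have "s k + s l \<in> subset_sums a (Suc n)"
      using k_mem l by (intro pair_mem) (auto simp: small_def)
    moreover have "s k + s l < a (Suc n)"
      using subset_sums_pred_le[OF s_k] subset_sums_pred_le[OF small_mem[OF l]] k_mem(2)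
        double_radius_less a_Suc_n_eq by simp
    ultimately show ?thesis
      using diff_mem_subset_sums_pred[of "s k + s l"] k_mem(2) by simp
  qed
  have "card (insert k small) \<le> n - 1"
  proof (rule card_le_if_pair_sums_mem_subset_sums[OF doubly_superincreasing_pred, of _ ?s])
    show "0 < ?s i \<and> ?s i \<in> subset_sums a (n - 1)" if "i \<in> insert k small" for i
      using that k_mem s_k small_mem s_pos by (auto simp: small_def)
    show "?s i + ?s l \<in> subset_sums a (n - 1)"
      if "i \<in> insert k small" "l \<in> insert k small" "i \<noteq> l" for i l
      using that k_mem(3) s_k_pair small_pair_mem by (auto simp: add.commute)
  qed
  then show ?thesis using k_mem(3) finite_small by simp
qed

lemma card_le: "card K \<le> n + 1"
  using card_eq card_small card_large card_small_if_three_large two_le_n by linarith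

end

context C1_C2_sequence
begin

lemma setB_eq: "setB a n = (subset_sums a (n - 1) + {0, a (Suc n)}) \<union> {centre}"
  by (auto simp: setB_def setA_def subset_sums_def centre_def set_plus_def)

lemma setC_eq: "setC a n = subset_sums a (Suc n)"
  by (simp add: setC_def subset_sums_def)

lemma radius_mem: "radius \<in> subset_sums a (n - 1)"
  unfolding radius_def by (rule sum_mem_subset_sums)

lemma setB_cases:
  assumes "b \<in> setB a n"
  obtains (low) "b \<in> subset_sums a (n - 1)" "b \<le> radius"
    | (centre) "b = centre"
    | (high) "centre + radius < b" "b \<le> 2 * centre"
proof -
  have "centre + radius < t + a (Suc n)" "t + a (Suc n) \<le> 2 * centre"
    if "t \<in> subset_sums a (n - 1)" for t
    using subset_sums_pred_le[OF that] double_radius_less by (simp_all add: centre_eq a_Suc_n_eq)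
  then show thesis using assms that subset_sums_pred_le by (auto simp: setB_eq set_plus_def)
qed

lemma zero_mem_setB: "0 \<in> setB a n"
  using zero_mem_subset_sums by (force simp: setB_eq set_plus_def)

lemma double_centre_mem_setB: "2 * centre \<in> setB a n"
proof -
  have "2 * centre = radius + a (Suc n)" by (simp add: centre_eq a_Suc_n_eq)
  then show ?thesis using radius_mem by (auto simp: setB_eq)
qed

lemma setB_le: "b \<in> setB a n \<Longrightarrow> b \<le> 2 * centre"
  by (erule setB_cases) (auto simp: centre_eq)

lemma Max_setB: "Max (setB a n) = 2 * centre"
proof (rule Max_eqI)
  have "setB a n \<subseteq> {..2 * centre}" using setB_le by auto
  then show "finite (setB a n)" by (rule finite_subset) simp
qed (use setB_le double_centre_mem_setB in auto)

lemma double_notin_setB: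
  assumes "b \<in> setB a n" "0 < b" "b \<le> radius"
  shows "2 * b \<notin> setB a n"
proof
  have low: "t \<in> subset_sums a (n - 1)" if "t \<in> setB a n" "t \<le> 2 * radius" for t
    using that(1) by (cases rule: setB_cases)
      (use that(2) double_radius_less in \<open>simp_all add: centre_eq\<close>)
  assume "2 * b \<in> setB a n"
  then have "2 * b \<in> subset_sums a (n - 1)" using assms(3) by (intro low) simp_all
  moreover have "b \<in> subset_sums a (n - 1)" using assms(1,3) by (intro low) simp_all
  ultimately show False using double_notin_subset_sums[OF doubly_superincreasing_pred] assms(2) by blast
qed

lemma three_cluster_product_setB:
  assumes "submodule_product K V W (setB a n)"
  shows "three_cluster_product K V W (setB a n) radius centre"
proof -
  interpret submodule_product K V W "setB a n" by (rule assms)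
  show ?thesis
  proof
    show "b \<le> radius" if "b \<in> setB a n" "b < centre" for b
      using that by (auto elim: setB_cases)
    show "centre + radius < b" if "b \<in> setB a n" "centre < b" for b
      using that by (auto elim: setB_cases simp: centre_eq)
    show "\<exists>b\<in>setB a n. 0 < b \<and> b < centre"
      using radius_mem radius_pos double_radius_less
      by (intro bexI[of _ radius]) (force simp: setB_eq set_plus_def centre_eq)+
    show "2 * radius < centre" using double_radius_less by (simp add: centre_eq)
  qed (use setB_le double_notin_setB in \<open>auto simp: setB_eq\<close>)
qed

lemma setC_eq_setB_plus: "setC a n = setB a n + {0, a n}"
proof -
  have "setC a n = subset_sums a (n - 1) + {0, a (Suc n)} + {0, a n}"
    unfolding setC_eq subset_sums_Suc subset_sums_n by (simp only: ac_simps)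
  moreover have "{centre} + {0, a n} \<subseteq> subset_sums a (n - 1) + {0, a (Suc n)} + {0, a n}"
  proof -
    have "centre = radius + 0 + a n" "centre + a n = 0 + a (Suc n) + 0"
      by (simp_all add: centre_eq a_Suc_n_eq)
    then have "centre \<in> subset_sums a (n - 1) + {0, a (Suc n)} + {0, a n}"
        "centre + a n \<in> subset_sums a (n - 1) + {0, a (Suc n)} + {0, a n}"
      using radius_mem zero_mem_subset_sums by (metis insertI1 insertI2 set_plus_intro)+
    then show ?thesis by (auto simp: set_plus_def)
  qed
  ultimately show ?thesis unfolding setB_eq Un_set_plus by blast
qed

end

section \<open>The grading of the polynomial ring by two variables\<close>

text \<open>
  The substitution sends $x$ to $T$, $y$ to $T Y$ and every other variable to a variable of the
  coefficient ring, so the coefficient of $T^d$ is the dehomogenized part of degree $d$ in $x, y$.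
  The other variables are renumbered by natural numbers because polynomial mappings are an instance
  of idom only for linearly ordered exponents.
\<close>

locale two_variables =
  fixes x y :: "'v::finite"
  assumes x_neq_y: "x \<noteq> y"
begin

abbreviation xy_degree :: "('v \<Rightarrow>\<^sub>0 nat) \<Rightarrow> nat" where
  "xy_degree \<mu> \<equiv> Poly_Mapping.lookup \<mu> x + Poly_Mapping.lookup \<mu> y"

definition rest :: "('v \<Rightarrow>\<^sub>0 nat) \<Rightarrow> (nat \<Rightarrow>\<^sub>0 nat)" where
  "rest \<mu> = (\<Sum>v\<in>UNIV - {x, y}. Poly_Mapping.single (to_nat v) (Poly_Mapping.lookup \<mu> v))"

definition strip :: "('v \<Rightarrow>\<^sub>0 nat) \<Rightarrow> ('v \<Rightarrow>\<^sub>0 nat)" where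
  "strip \<mu> = Poly_Mapping.update x 0 (Poly_Mapping.update y 0 \<mu>)"

definition form_term :: "('v \<Rightarrow>\<^sub>0 nat) \<Rightarrow> 'a \<Rightarrow> ((nat \<Rightarrow>\<^sub>0 nat) \<Rightarrow>\<^sub>0 'a::idom) poly poly" where
  "form_term \<mu> k =
    monom (monom (Poly_Mapping.single (rest \<mu>) k) (Poly_Mapping.lookup \<mu> y)) (xy_degree \<mu>)"

definition form_map :: "('v, 'a) mpoly \<Rightarrow> ((nat \<Rightarrow>\<^sub>0 nat) \<Rightarrow>\<^sub>0 'a::idom) poly poly" where
  "form_map f = (\<Sum>\<mu>\<in>Poly_Mapping.keys f. form_term \<mu> (Poly_Mapping.lookup f \<mu>))"

lemma lookup_rest:
  assumes "v \<notin> {x, y}"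
  shows "Poly_Mapping.lookup (rest \<mu>) (to_nat v) = Poly_Mapping.lookup \<mu> v"
proof -
  have "Poly_Mapping.lookup (rest \<mu>) (to_nat v)
      = (\<Sum>w\<in>UNIV - {x, y}. if w = v then Poly_Mapping.lookup \<mu> w else 0)"
    unfolding rest_def lookup_sum by (rule sum.cong) (auto simp: lookup_single when_def)
  then show ?thesis using assms by simp
qed

lemma rest_add: "rest (\<mu> + \<nu>) = rest \<mu> + rest \<nu>"
  by (simp add: rest_def lookup_add single_add sum.distrib)

lemma rest_strip: "rest (strip \<mu>) = rest \<mu>"
  unfolding rest_def strip_def by (rule sum.cong) (auto simp: lookup_update)

lemma rest_single:
  assumes "v \<in> {x, y}"
  shows "rest (Poly_Mapping.single v i) = 0"
  unfolding rest_def using assms by (intro sum.neutral) (auto simp: lookup_single when_def)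

lemma rest_inject:
  assumes "rest \<mu> = rest \<nu>" "xy_degree \<mu> = xy_degree \<nu>"
    and "Poly_Mapping.lookup \<mu> y = Poly_Mapping.lookup \<nu> y"
  shows "\<mu> = \<nu>"
proof (rule poly_mapping_eqI)
  fix v
  show "Poly_Mapping.lookup \<mu> v = Poly_Mapping.lookup \<nu> v"
    using assms lookup_rest[of v \<mu>] lookup_rest[of v \<nu>] by (cases "v \<in> {x, y}") auto
qed

lemma form_term_0: "form_term \<mu> 0 = 0"
  by (simp add: form_term_def)

lemma form_term_add: "form_term \<mu> (k + l) = form_term \<mu> k + form_term \<mu> l"
  by (simp add: form_term_def single_add add_monom)

lemma form_term_mult: "form_term (\<mu> + \<nu>) (k * l) = form_term \<mu> k * form_term \<nu> l"
  by (simp add: form_term_def rest_add lookup_add mult_monom mult_single ac_simps)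

lemma form_term_strip: "form_term (strip \<mu>) k = [:[:Poly_Mapping.single (rest \<mu>) k:]:]"
  by (simp add: form_term_def rest_strip) (simp add: strip_def lookup_update monom_0)

lemma form_map_add: "form_map (f + g) = form_map f + form_map g"
  unfolding form_map_def
  by (rule setsum_keys_plus_distrib) (simp_all add: form_term_0 form_term_add)

lemma additive_form_map: "additive form_map"
  by (rule additive.intro) (rule form_map_add)

lemma form_map_single: "form_map (Poly_Mapping.single \<mu> k) = form_term \<mu> k"
  by (simp add: form_map_def form_term_0)

lemma sum_single_keys:
  "f = (\<Sum>\<mu>\<in>Poly_Mapping.keys f. Poly_Mapping.single \<mu> (Poly_Mapping.lookup f \<mu>))"
  by (rule poly_mapping_eqI) (auto simp: lookup_sum lookup_single when_def in_keys_iff)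

lemma form_map_mult: "form_map (f * g) = form_map f * form_map g"
proof -
  have "f * g = (\<Sum>\<mu>\<in>Poly_Mapping.keys f. \<Sum>\<nu>\<in>Poly_Mapping.keys g.
      Poly_Mapping.single (\<mu> + \<nu>) (Poly_Mapping.lookup f \<mu> * Poly_Mapping.lookup g \<nu>))"
    by (subst sum_single_keys[of f], subst sum_single_keys[of g])
      (simp add: sum_product mult_single)
  then have "form_map (f * g) = (\<Sum>\<mu>\<in>Poly_Mapping.keys f. \<Sum>\<nu>\<in>Poly_Mapping.keys g.
      form_term (\<mu> + \<nu>) (Poly_Mapping.lookup f \<mu> * Poly_Mapping.lookup g \<nu>))"
    by (simp add: additive.sum[OF additive_form_map] form_map_single)
  also have "\<dots> = form_map f * form_map g"
    by (simp add: form_term_mult form_map_def sum_product)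
  finally show ?thesis .
qed

lemma coeff_coeff_form_map:
  "coeff (coeff (form_map f) d) j =
    (\<Sum>\<mu> | \<mu> \<in> Poly_Mapping.keys f \<and> xy_degree \<mu> = d \<and> Poly_Mapping.lookup \<mu> y = j.
      Poly_Mapping.single (rest \<mu>) (Poly_Mapping.lookup f \<mu>))"
  unfolding form_map_def coeff_sum sum.inter_filter[OF finite_keys] form_term_def
  by (rule sum.cong) auto

lemma lookup_form_map:
  "Poly_Mapping.lookup
    (coeff (coeff (form_map f) (xy_degree \<mu>)) (Poly_Mapping.lookup \<mu> y)) (rest \<mu>)
    = Poly_Mapping.lookup f \<mu>"
proof -
  let ?S = "{\<nu> \<in> Poly_Mapping.keys f.
      xy_degree \<nu> = xy_degree \<mu> \<and> Poly_Mapping.lookup \<nu> y = Poly_Mapping.lookup \<mu> y}"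
  have "Poly_Mapping.lookup
      (coeff (coeff (form_map f) (xy_degree \<mu>)) (Poly_Mapping.lookup \<mu> y)) (rest \<mu>)
      = (\<Sum>\<nu>\<in>?S. if \<nu> = \<mu> then Poly_Mapping.lookup f \<nu> else 0)"
    unfolding coeff_coeff_form_map lookup_sum
    by (rule sum.cong) (auto simp: lookup_single when_def dest: rest_inject)
  also have "\<dots> = Poly_Mapping.lookup f \<mu>"
    by (auto simp: in_keys_iff)
  finally show ?thesis .
qed

lemma form_map_eq_0:
  assumes "form_map f = 0"
  shows "f = 0"
proof (rule poly_mapping_eqI)
  show "Poly_Mapping.lookup f \<mu> = Poly_Mapping.lookup 0 \<mu>" for \<mu>
    using lookup_form_map[of f \<mu>] by (simp add: assms)
qed

lemma degree_coeff_form_map: "degree (coeff (form_map f) d) \<le> d"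
  unfolding form_map_def coeff_sum
  by (rule degree_sum_le) (auto simp: form_term_def intro: order_trans[OF degree_monom_le])

lemma exists_form_map_eq_coeff: "\<exists>r. form_map r = [:[:coeff (coeff (form_map f) d) j:]:]"
proof
  let ?S = "{\<mu> \<in> Poly_Mapping.keys f. xy_degree \<mu> = d \<and> Poly_Mapping.lookup \<mu> y = j}"
  have "form_map (\<Sum>\<mu>\<in>?S. Poly_Mapping.single (strip \<mu>) (Poly_Mapping.lookup f \<mu>))
      = (\<Sum>\<mu>\<in>?S. [:[:Poly_Mapping.single (rest \<mu>) (Poly_Mapping.lookup f \<mu>):]:])"
    by (simp add: additive.sum[OF additive_form_map] form_map_single form_term_strip)
  also have "\<dots> = [:[:coeff (coeff (form_map f) d) j:]:]"
    by (simp add: coeff_coeff_form_map flip: monom_0 monom_sum)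
  finally show "form_map (\<Sum>\<mu>\<in>?S. Poly_Mapping.single (strip \<mu>) (Poly_Mapping.lookup f \<mu>))
    = [:[:coeff (coeff (form_map f) d) j:]:]" .
qed

lemma single_mem_ideal:
  assumes I: "is_ideal I" "Poly_Mapping.single (Poly_Mapping.single v 1) 1 \<in> I"
    and v: "0 < Poly_Mapping.lookup \<mu> v"
  shows "Poly_Mapping.single \<mu> k \<in> (I :: ('v, 'a::idom) mpoly set)"
proof -
  have "\<mu> = (\<mu> - Poly_Mapping.single v 1) + Poly_Mapping.single v 1"
    using v by (intro poly_mapping_eqI) (auto simp: lookup_add lookup_minus lookup_single when_def)
  then have "Poly_Mapping.single \<mu> k =
      Poly_Mapping.single (\<mu> - Poly_Mapping.single v 1) k
        * Poly_Mapping.single (Poly_Mapping.single v 1) 1"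
    by (simp add: mult_single)
  then show ?thesis using I by (simp add: is_ideal_mult_left)
qed

lemma mem_ideal_gen_if_coeff_form_map_0:
  assumes "coeff (form_map f) 0 = 0"
  shows "f \<in> ideal_gen {monoXY x y 1 0, monoXY x y 0 1}"
proof -
  let ?I = "ideal_gen {monoXY x y 1 0, monoXY x y 0 1} :: ('v, 'a) mpoly set"
  have generators: "Poly_Mapping.single (Poly_Mapping.single x 1) 1 \<in> ?I"
      "Poly_Mapping.single (Poly_Mapping.single y 1) 1 \<in> ?I"
    by (rule ideal_gen_base; simp add: monoXY_def)+
  have "Poly_Mapping.single \<mu> (Poly_Mapping.lookup f \<mu>) \<in> ?I" if "\<mu> \<in> Poly_Mapping.keys f" for \<mu>
  proof -
    have "xy_degree \<mu> \<noteq> 0"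
    proof
      assume "xy_degree \<mu> = 0"
      then have "Poly_Mapping.lookup f \<mu> = 0"
        using lookup_form_map[of f \<mu>] assms by (simp only: coeff_0 lookup_zero)
      then show False using that by (simp add: in_keys_iff)
    qed
    then consider "0 < Poly_Mapping.lookup \<mu> x" | "0 < Poly_Mapping.lookup \<mu> y" by auto
    then show ?thesis
      by cases (rule single_mem_ideal[OF is_ideal_ideal_gen generators(1)]
        single_mem_ideal[OF is_ideal_ideal_gen generators(2)]; assumption)+
  qed
  then have "(\<Sum>\<mu>\<in>Poly_Mapping.keys f. Poly_Mapping.single \<mu> (Poly_Mapping.lookup f \<mu>)) \<in> ?I"
    by (intro is_ideal_sum is_ideal_ideal_gen)
  then show ?thesis unfolding sum_single_keys[of f, symmetric] .
qed

lemma form_grading_form_map: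
  "form_grading (form_map :: ('v, 'a::idom) mpoly \<Rightarrow> _) (monoXY x y 1 0) (monoXY x y 0 1)"
proof
  show "form_map (monoXY x y 1 0 :: ('v, 'a) mpoly) = monom 1 1"
    and "form_map (monoXY x y 0 1 :: ('v, 'a) mpoly) = monom (monom 1 1) 1"
    using x_neq_y
    by (simp_all add: monoXY_def form_map_single form_term_def rest_single lookup_single when_def)
qed (fact form_map_add form_map_mult form_map_eq_0 degree_coeff_form_map exists_form_map_eq_coeff
    mem_ideal_gen_if_coeff_form_map_0)+

lemma monoXY_eq_power_mult:
  "monoXY x y i j = (monoXY x y 1 0 ^ i * monoXY x y 0 1 ^ j :: ('v, 'a::idom) mpoly)"
proof -
  have "Poly_Mapping.single (Poly_Mapping.single v 1) 1 ^ i
      = (Poly_Mapping.single (Poly_Mapping.single v i) 1 :: ('v, 'a) mpoly)" for v i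
    by (induction i) (simp_all add: mult_single flip: single_add)
  then show ?thesis by (simp add: monoXY_def mult_single)
qed

end

section \<open>Factorizations of the monomial ideals\<close>

lemma (in form_grading) mem_ideal_lengths_mono_ideal_subset_sums:
  assumes "\<And>i. i \<in> {1..j} \<Longrightarrow> 0 < a i"
  shows "j \<in> ideal_lengths (mono_ideal (sum a {1..j}) (subset_sums a j))"
  using assms
proof (induction j)
  case 0
  then show ?case by (simp add: subset_sums_0 mono_ideal_0 zero_mem_ideal_lengths_UNIV)
next
  case (Suc j)
  have "subset_sums a j \<subseteq> {..sum a {1..j}}" using subset_sums_le by blast
  then have "ideal_mult (mono_ideal (a (Suc j)) {0, a (Suc j)})
        (mono_ideal (sum a {1..j}) (subset_sums a j))
      = mono_ideal (sum a {1..Suc j}) (subset_sums a (Suc j))"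
    by (simp add: mono_ideal_mult subset_sums_Suc atLeastAtMostSuc_conv add.commute)
  moreover have "ideal_atom (mono_ideal (a (Suc j)) {0, a (Suc j)})"
    using Suc.prems by (intro ideal_atom_mono_ideal_two) simp
  ultimately show ?case using Suc_mem_ideal_lengths Suc.IH Suc.prems by fastforce
qed

locale graded_C1_C2_sequence = form_grading + C1_C2_sequence
begin

abbreviation ideal_B :: "'a set" where
  "ideal_B \<equiv> mono_ideal (Max (setB a n)) (setB a n)"

abbreviation ideal_C :: "'a set" where
  "ideal_C \<equiv> mono_ideal (sum a {1..n+1}) (setC a n)"

lemma ideal_atom_ideal_B: "ideal_atom ideal_B"
proof (rule ideal_atom_mono_idealI)
  show "setB a n \<subseteq> {..Max (setB a n)}" using setB_le by (auto simp: Max_setB)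
  show "Max (setB a n) \<in> setB a n" by (simp add: Max_setB double_centre_mem_setB)
  show "0 < Max (setB a n)" using radius_pos by (simp add: Max_setB centre_eq)
  show "orders V \<subseteq> {0} \<or> orders W \<subseteq> {0}" if "submodule_product const_coeffs V W (setB a n)" for V W
    using three_cluster_product_setB[OF that] by (rule three_cluster_product.trivial_orders)
qed (rule zero_mem_setB)

lemma ideal_atom_a_n: "ideal_atom (mono_ideal (a n) {0, a n})"
  using a_pos two_le_n by (intro ideal_atom_mono_ideal_two) simp

lemma ideal_C_eq_ideal_mult: "ideal_C = ideal_mult ideal_B (mono_ideal (a n) {0, a n})"
proof -
  have "setB a n \<subseteq> {..2 * centre}" using setB_le by auto
  then have "ideal_mult ideal_B (mono_ideal (a n) {0, a n})
      = mono_ideal (2 * centre + a n) (setC a n)"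
    by (simp add: Max_setB mono_ideal_mult setC_eq_setB_plus)
  then show ?thesis using sum_Suc_n by simp
qed

lemma Suc_n_mem_ideal_lengths_ideal_C: "n + 1 \<in> ideal_lengths ideal_C"
  using mem_ideal_lengths_mono_ideal_subset_sums[of "n + 1" a] a_pos by (simp add: setC_eq)

lemma ideal_lengths_ideal_C_le:
  assumes "k \<in> ideal_lengths ideal_C"
  shows "k \<le> n + 1"
proof -
  have "setC a n \<subseteq> {..sum a {1..n+1}}" "0 \<in> setC a n" "sum a {1..n+1} \<in> setC a n"
    unfolding setC_eq Suc_eq_plus1[symmetric]
    using subset_sums_le zero_mem_subset_sums sum_mem_subset_sums by blast+
  then obtain s where "\<And>i. i < k \<Longrightarrow> 0 < s i" "\<And>K. K \<subseteq> {..<k} \<Longrightarrow> sum s K \<in> setC a n"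
    using assms by (rule ideal_lengths_mono_ideal_subset_sums) blast
  then interpret subset_sums_family a n "{..<k}" s
    by unfold_locales (simp_all add: setC_eq)
  show ?thesis using card_le by simp
qed

end

theorem theorem3p5:
  fixes a :: "nat \<Rightarrow> nat" and n :: nat and x y :: "'v::finite"
  assumes N2: "CARD('v) \<ge> 2"
    and xy: "x \<noteq> y"
    and BF: "ideal_BF TYPE(('v, 'a::idom) mpoly)"
    and n2: "n \<ge> 2"
    and apos: "\<forall>i\<in>{1..n+1}. a i > 0"
    and C1: "a (n+1) = (\<Sum>i\<in>{1..n-1}. a i) + 2 * a n"
    and C2: "\<forall>i\<in>{1..n-1}. a (i+1) > 2 * (\<Sum>j\<in>{1..i}. a j)"
  defines "IB \<equiv> ideal_gen ((\<lambda>b. monoXY x y (Max (setB a n) - b) b) ` setB a n) :: ('v, 'a) mpoly set"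
    and "IC \<equiv> ideal_gen ((\<lambda>c. monoXY x y ((\<Sum>i\<in>{1..n+1}. a i) - c) c) ` setC a n) :: ('v, 'a) mpoly set"
  shows "ideal_atom IB \<and> {2, n+1} \<subseteq> ideal_lengths IC \<and> ideal_lengths IC \<subseteq> {2..n+1}"
proof -
  interpret R: two_variables x y by unfold_locales (rule xy)
  interpret form_grading "R.form_map :: ('v, 'a) mpoly \<Rightarrow> _" "monoXY x y 1 0" "monoXY x y 0 1"
    by (rule R.form_grading_form_map)
  interpret C1_C2_sequence a n
    by (rule C1_C2_sequenceI[OF n2 apos C1 C2])
  interpret graded_C1_C2_sequence "R.form_map :: ('v, 'a) mpoly \<Rightarrow> _"
    "monoXY x y 1 0" "monoXY x y 0 1" a n ..
  have "IB = ideal_B" "IC = ideal_C"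
    unfolding IB_def IC_def mono_ideal_def by (simp_all only: R.monoXY_eq_power_mult[symmetric])
  moreover have "2 \<in> ideal_lengths ideal_C" "k \<in> ideal_lengths ideal_C \<Longrightarrow> 2 \<le> k" for k
    using ideal_lengths_ideal_mult_atoms[OF ideal_atom_ideal_B ideal_atom_a_n]
    unfolding ideal_C_eq_ideal_mult by blast+
  ultimately show ?thesis
    using ideal_atom_ideal_B Suc_n_mem_ideal_lengths_ideal_C ideal_lengths_ideal_C_le by auto
qed

end
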